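(* Let $(M_1,g_1)$ and $(M_2,g_2)$ be pseudo-Riemannian manifolds of dimensions $n_1,n_2\ge 2$, let $f\colon M_1\to(0,\infty)$ be smooth, and let $M=M_1\times_f M_2$ be the warped product manifold with metric $g=g_1\oplus f^2g_2$, of dimension $n=n_1+n_2$ and scalar curvature $\tau$. If $X_i,Y_i,Z_i\in\mathfrak X(M_i)$, $i=1,2$, then the concircular curvature tensor $\mathcal C$ of $M$ satisfies $$\mathcal C(X_1,Y_1)Z_1=\mathcal R^1(X_1,Y_1)Z_1-\frac{\tau}{n(n-1)}\left[g_1(X_1,Z_1)Y_1-g_1(Y_1,Z_1)X_1\right],$$ $$\mathcal C(X_2,Y_1)Z_1=\left[\frac1f H^f(Y_1,Z_1)+\frac{\tau}{n(n-1)}g_1(Y_1,Z_1)\right]X_2,$$ $$\mathcal C(X_1,Y_2)Z_2=f\,g_2(Y_2,Z_2)\left[\nabla^1_{X_1}\mathrm{grad} f+\frac{\tau f}{n(n-1)}X_1\right],$$ $$\mathcal C(X_2,Y_2)Z_2=\mathcal R^2(X_2,Y_2)Z_2-\left(\|\mathrm{grad} f\|_1^2+\frac{\tau f^2}{n(n-1)}\right)\left[g_2(X_2,Z_2)Y_2-g_2(Y_2,Z_2)X_2\right],$$ where $H^f(Y_1,Z_1)=g_1(\nabla^1_{Y_1}\mathrm{grad} f,Z_1)$ is the Hessian of $f$.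
   Context: The warped product metric is $g=\pi_1^*(g_1)+(f\circ\pi_1)^2\pi_2^*(g_2)$ on $M_1\times M_2$, with $\pi_i$ the natural projections. Vector fields on $M_i$ and their lifts to $M$ are denoted by the same symbol. The curvature convention is $\mathcal R(X,Y)Z=\nabla_Y\nabla_XZ-\nabla_X\nabla_YZ+\nabla_{[X,Y]}Z$; $\nabla^i$ and $\mathcal R^i$ are the Levi-Civita connection and curvature tensor of $(M_i,g_i)$. The concircular curvature tensor is $\mathcal C(X,Y)Z=\mathcal R(X,Y)Z-\frac{\tau}{n(n-1)}[g(X,Z)Y-g(Y,Z)X]$. $\mathrm{grad} f$ is the gradient of $f$ on $(M_1,g_1)$ and $\|\mathrm{grad} f\|_1^2=g_1(\mathrm{grad} f,\mathrm{grad} f)$. *)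

theory Defs
  imports "HOL-Analysis.Analysis"
begin

text \<open>A manifold is a whole type \<open>'a\<close> (Hausdorff and second countable) with a smooth atlas modelled
  on a Euclidean space \<open>'e\<close>; its dimension is \<open>DIM('e)\<close>. Smoothness means \<open>C\<^sup>\<infinity>\<close>. The derivative
  below is only used at points of open sets; on a finite-dimensional space, controlling all
  directional derivatives up to order \<open>k\<close> is the same as being of class \<open>C\<^sup>k\<close>.\<close>

primrec Ck_on :: "nat \<Rightarrow> ('a::real_normed_vector \<Rightarrow> 'b::real_normed_vector) \<Rightarrow> 'a set \<Rightarrow> bool" where
  "Ck_on 0 f S \<longleftrightarrow> continuous_on S f"
| "Ck_on (Suc k) f S \<longleftrightarrow>
     (\<forall>x\<in>S. f differentiable (at x)) \<and> (\<forall>v. Ck_on k (\<lambda>x. frechet_derivative f (at x) v) S)"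

definition smooth_on :: "'a::real_normed_vector set \<Rightarrow> ('a \<Rightarrow> 'b::real_normed_vector) \<Rightarrow> bool" where
  "smooth_on S f \<longleftrightarrow> (\<forall>k. Ck_on k f S)"

type_synonym ('a, 'e) chart = "'a set \<times> ('a \<Rightarrow> 'e)"
type_synonym ('a, 'e) atlas = "('a, 'e) chart set"

definition is_chart :: "('a::topological_space, 'e::euclidean_space) chart \<Rightarrow> bool" where
  "is_chart c \<longleftrightarrow> (case c of (U, \<phi>) \<Rightarrow>
     open U \<and> open (\<phi> ` U) \<and> inj_on \<phi> U \<and> homeomorphism U (\<phi> ` U) \<phi> (inv_into U \<phi>))"

definition smooth_manifold ::
  "('a::{t2_space, second_countable_topology}, 'e::euclidean_space) atlas \<Rightarrow> bool" where
  "smooth_manifold A \<longleftrightarrow>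
     (\<forall>c\<in>A. is_chart c) \<and> (\<Union>(U, \<phi>)\<in>A. U) = UNIV \<and>
     (\<forall>(U, \<phi>)\<in>A. \<forall>(V, \<psi>)\<in>A. smooth_on (\<phi> ` (U \<inter> V)) (\<psi> \<circ> inv_into U \<phi>))"

definition smooth_fun :: "('a, 'e::euclidean_space) atlas \<Rightarrow> ('a \<Rightarrow> real) \<Rightarrow> bool" where
  "smooth_fun A h \<longleftrightarrow> (\<forall>(U, \<phi>)\<in>A. smooth_on (\<phi> ` U) (h \<circ> inv_into U \<phi>))"

definition prod_atlas ::
  "('a, 'e::euclidean_space) atlas \<Rightarrow> ('b, 'f::euclidean_space) atlas \<Rightarrow> ('a \<times> 'b, 'e \<times> 'f) atlas"
  where
  "prod_atlas A B = {(U \<times> V, map_prod \<phi> \<psi>) | U \<phi> V \<psi>. (U, \<phi>) \<in> A \<and> (V, \<psi>) \<in> B}"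

text \<open>Real functionals on functions, as a type of their own so as to be an instance of
  \<^class>\<open>real_vector\<close>.\<close>

typedef 'a tvec = "UNIV :: (('a \<Rightarrow> real) \<Rightarrow> real) set"
  morphisms tapply Tvec by simp

setup_lifting type_definition_tvec

instantiation tvec :: (type) real_vector
begin

lift_definition zero_tvec :: "'a tvec" is "\<lambda>h. 0" .
lift_definition plus_tvec :: "'a tvec \<Rightarrow> 'a tvec \<Rightarrow> 'a tvec" is "\<lambda>v w h. v h + w h" .
lift_definition minus_tvec :: "'a tvec \<Rightarrow> 'a tvec \<Rightarrow> 'a tvec" is "\<lambda>v w h. v h - w h" .
lift_definition uminus_tvec :: "'a tvec \<Rightarrow> 'a tvec" is "\<lambda>v h. - v h" .
lift_definition scaleR_tvec :: "real \<Rightarrow> 'a tvec \<Rightarrow> 'a tvec" is "\<lambda>c v h. c * v h" .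

instance
  by standard (transfer; simp add: fun_eq_iff algebra_simps)+

end

text \<open>Tangent vectors at \<open>p\<close> are the derivations at \<open>p\<close> of the algebra of smooth functions. They take
  the value \<open>0\<close> on functions that are not smooth, so that equality of derivations is equality in
  \<open>'a tvec\<close>.\<close>

definition tangent_space :: "('a, 'e::euclidean_space) atlas \<Rightarrow> 'a \<Rightarrow> 'a tvec set" where
  "tangent_space A p = {v.
     (\<forall>h. \<not> smooth_fun A h \<longrightarrow> tapply v h = 0) \<and>
     (\<forall>h k. smooth_fun A h \<longrightarrow> smooth_fun A k \<longrightarrow>
        tapply v (\<lambda>x. h x + k x) = tapply v h + tapply v k) \<and>
     (\<forall>c h. smooth_fun A h \<longrightarrow> tapply v (\<lambda>x. c * h x) = c * tapply v h) \<and>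
     (\<forall>h k. smooth_fun A h \<longrightarrow> smooth_fun A k \<longrightarrow>
        tapply v (\<lambda>x. h x * k x) = h p * tapply v k + k p * tapply v h)}"

definition tangent_map ::
  "('a, 'e::euclidean_space) atlas \<Rightarrow> ('b, 'f::euclidean_space) atlas \<Rightarrow> ('a \<Rightarrow> 'b) \<Rightarrow> 'a tvec \<Rightarrow> 'b tvec"
  where
  "tangent_map A B F v = Tvec (\<lambda>k. if smooth_fun B k then tapply v (k \<circ> F) else 0)"

type_synonym 'a vfield = "'a \<Rightarrow> 'a tvec"

definition field_apply :: "'a vfield \<Rightarrow> ('a \<Rightarrow> real) \<Rightarrow> 'a \<Rightarrow> real" where
  "field_apply X h = (\<lambda>p. tapply (X p) h)"

definition vector_fields :: "('a, 'e::euclidean_space) atlas \<Rightarrow> 'a vfield set" where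
  "vector_fields A = {X. (\<forall>p. X p \<in> tangent_space A p) \<and>
     (\<forall>h. smooth_fun A h \<longrightarrow> smooth_fun A (field_apply X h))}"

definition lie_bracket :: "'a vfield \<Rightarrow> 'a vfield \<Rightarrow> 'a vfield" where
  "lie_bracket X Y = (\<lambda>p. Tvec (\<lambda>h. tapply (X p) (field_apply Y h) - tapply (Y p) (field_apply X h)))"

type_synonym 'a metric = "'a \<Rightarrow> 'a tvec \<Rightarrow> 'a tvec \<Rightarrow> real"
type_synonym 'a connection = "'a vfield \<Rightarrow> 'a vfield \<Rightarrow> 'a vfield"

definition pseudo_riemannian ::
  "('a::{t2_space, second_countable_topology}, 'e::euclidean_space) atlas \<Rightarrow> 'a metric \<Rightarrow> bool" where
  "pseudo_riemannian A g \<longleftrightarrow> smooth_manifold A \<and>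
     (\<forall>p. \<forall>u\<in>tangent_space A p. \<forall>v\<in>tangent_space A p.
        g p u v = g p v u \<and>
        (\<forall>c. g p (c *\<^sub>R u) v = c * g p u v) \<and>
        (\<forall>w\<in>tangent_space A p. g p (u + w) v = g p u v + g p w v)) \<and>
     (\<forall>p. \<forall>u\<in>tangent_space A p. (\<forall>v\<in>tangent_space A p. g p u v = 0) \<longrightarrow> u = 0) \<and>
     (\<forall>X\<in>vector_fields A. \<forall>Y\<in>vector_fields A. smooth_fun A (\<lambda>p. g p (X p) (Y p)))"

definition affine_connection :: "('a, 'e::euclidean_space) atlas \<Rightarrow> 'a connection \<Rightarrow> bool" where
  "affine_connection A D \<longleftrightarrow>
     (\<forall>X\<in>vector_fields A. \<forall>Y\<in>vector_fields A. D X Y \<in> vector_fields A) \<and>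
     (\<forall>X\<in>vector_fields A. \<forall>Y\<in>vector_fields A. \<forall>Z\<in>vector_fields A.
        D (\<lambda>p. X p + Y p) Z = (\<lambda>p. D X Z p + D Y Z p) \<and>
        D X (\<lambda>p. Y p + Z p) = (\<lambda>p. D X Y p + D X Z p)) \<and>
     (\<forall>X\<in>vector_fields A. \<forall>Y\<in>vector_fields A. \<forall>h. smooth_fun A h \<longrightarrow>
        D (\<lambda>p. h p *\<^sub>R X p) Y = (\<lambda>p. h p *\<^sub>R D X Y p) \<and>
        D X (\<lambda>p. h p *\<^sub>R Y p) = (\<lambda>p. field_apply X h p *\<^sub>R Y p + h p *\<^sub>R D X Y p))"

definition levi_civita :: "('a, 'e::euclidean_space) atlas \<Rightarrow> 'a metric \<Rightarrow> 'a connection \<Rightarrow> bool" where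
  "levi_civita A g D \<longleftrightarrow> affine_connection A D \<and>
     (\<forall>X\<in>vector_fields A. \<forall>Y\<in>vector_fields A. \<forall>p.
        D X Y p - D Y X p = lie_bracket X Y p) \<and>
     (\<forall>X\<in>vector_fields A. \<forall>Y\<in>vector_fields A. \<forall>Z\<in>vector_fields A. \<forall>p.
        field_apply X (\<lambda>q. g q (Y q) (Z q)) p = g p (D X Y p) (Z p) + g p (Y p) (D X Z p))"

definition gradient ::
  "('a, 'e::euclidean_space) atlas \<Rightarrow> 'a metric \<Rightarrow> ('a \<Rightarrow> real) \<Rightarrow> 'a vfield" where
  "gradient A g f = (THE G. G \<in> vector_fields A \<and>
     (\<forall>X\<in>vector_fields A. \<forall>p. g p (G p) (X p) = field_apply X f p))"

definition hessian ::
  "('a, 'e::euclidean_space) atlas \<Rightarrow> 'a metric \<Rightarrow> 'a connection \<Rightarrow> ('a \<Rightarrow> real)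
     \<Rightarrow> 'a vfield \<Rightarrow> 'a vfield \<Rightarrow> 'a \<Rightarrow> real" where
  "hessian A g D f Y Z = (\<lambda>p. g p (D Y (gradient A g f) p) (Z p))"

text \<open>This sign convention is opposite to the more common
  \<open>\<nabla>\<^sub>X \<nabla>\<^sub>Y Z - \<nabla>\<^sub>Y \<nabla>\<^sub>X Z - \<nabla>\<^bsub>[X,Y]\<^esub> Z\<close>.\<close>

definition curvature :: "'a connection \<Rightarrow> 'a vfield \<Rightarrow> 'a vfield \<Rightarrow> 'a vfield \<Rightarrow> 'a vfield" where
  "curvature D X Y Z = (\<lambda>p. D Y (D X Z) p - D X (D Y Z) p + D (lie_bracket X Y) Z p)"

definition orthonormal_frame_at ::
  "('a, 'e::euclidean_space) atlas \<Rightarrow> 'a metric \<Rightarrow> 'a \<Rightarrow> (nat \<Rightarrow> 'a vfield) \<Rightarrow> bool" where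
  "orthonormal_frame_at A g p E \<longleftrightarrow>
     (\<forall>i<DIM('e). E i \<in> vector_fields A) \<and>
     (\<forall>i<DIM('e). \<forall>j<DIM('e). g p (E i p) (E j p) \<in> (if i = j then {1, -1} else {0}))"

text \<open>With the above sign of the curvature, \<open>Ric(X,Y)\<close> is the trace of \<open>V \<mapsto> R(X,V)Y\<close>, which makes
  the round sphere positively curved. Traces are computed in orthonormal bases of the tangent space
  at \<open>p\<close>, on whose choice they do not depend; the factor \<open>g(E\<^sub>i,E\<^sub>i) = \<plusminus>1\<close> is the sign of the basis
  vector.\<close>

definition ricci :: "('a, 'e::euclidean_space) atlas \<Rightarrow> 'a metric \<Rightarrow> 'a connection
     \<Rightarrow> 'a vfield \<Rightarrow> 'a vfield \<Rightarrow> 'a \<Rightarrow> real" where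
  "ricci A g D X Y p = (THE r. \<forall>E. orthonormal_frame_at A g p E \<longrightarrow>
     r = (\<Sum>i<DIM('e). g p (E i p) (E i p) * g p (curvature D X (E i) Y p) (E i p)))"

definition scalar_curvature ::
  "('a, 'e::euclidean_space) atlas \<Rightarrow> 'a metric \<Rightarrow> 'a connection \<Rightarrow> 'a \<Rightarrow> real" where
  "scalar_curvature A g D p = (THE s. \<forall>E. orthonormal_frame_at A g p E \<longrightarrow>
     s = (\<Sum>i<DIM('e). g p (E i p) (E i p) * ricci A g D (E i) (E i) p))"

definition concircular :: "('a, 'e::euclidean_space) atlas \<Rightarrow> 'a metric \<Rightarrow> 'a connection
     \<Rightarrow> 'a vfield \<Rightarrow> 'a vfield \<Rightarrow> 'a vfield \<Rightarrow> 'a vfield" where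
  "concircular A g D X Y Z = (\<lambda>p. let n = real DIM('e) in
     curvature D X Y Z p -
     (scalar_curvature A g D p / (n * (n - 1))) *\<^sub>R
       (g p (X p) (Z p) *\<^sub>R Y p - g p (Y p) (Z p) *\<^sub>R X p))"

definition pullback_metric ::
  "('a, 'e::euclidean_space) atlas \<Rightarrow> ('b, 'f::euclidean_space) atlas \<Rightarrow> ('a \<Rightarrow> 'b) \<Rightarrow> 'b metric \<Rightarrow> 'a metric"
  where
  "pullback_metric A B F g = (\<lambda>p v w. g (F p) (tangent_map A B F v) (tangent_map A B F w))"

definition warped_metric ::
  "('a, 'e::euclidean_space) atlas \<Rightarrow> 'a metric \<Rightarrow> ('a \<Rightarrow> real)
     \<Rightarrow> ('b, 'f::euclidean_space) atlas \<Rightarrow> 'b metric \<Rightarrow> ('a \<times> 'b) metric" where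
  "warped_metric A1 g1 f A2 g2 = (\<lambda>p v w.
     pullback_metric (prod_atlas A1 A2) A1 fst g1 p v w +
     ((f \<circ> fst) p)\<^sup>2 * pullback_metric (prod_atlas A1 A2) A2 snd g2 p v w)"

text \<open>The lift of a vector field on a factor is the field on the product that is related to the given
  one under the projection to that factor and to \<open>0\<close> under the other projection; it is obtained by
  transporting along the inclusions \<open>x \<mapsto> (x, q)\<close> and \<open>y \<mapsto> (p, y)\<close> of the slices.\<close>

definition lift1 :: "('a, 'e::euclidean_space) atlas \<Rightarrow> ('b, 'f::euclidean_space) atlas
     \<Rightarrow> 'a vfield \<Rightarrow> ('a \<times> 'b) vfield" where
  "lift1 A1 A2 X = (\<lambda>(p, q). tangent_map A1 (prod_atlas A1 A2) (\<lambda>x. (x, q)) (X p))"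

definition lift2 :: "('a, 'e::euclidean_space) atlas \<Rightarrow> ('b, 'f::euclidean_space) atlas
     \<Rightarrow> 'b vfield \<Rightarrow> ('a \<times> 'b) vfield" where
  "lift2 A1 A2 Y = (\<lambda>(p, q). tangent_map A2 (prod_atlas A1 A2) (\<lambda>y. (p, y)) (Y q))"

end

theory Submission
  imports Defs
begin

text \<open>The term with \<open>\<tau>\<close> is explicit, so only the curvature \<open>R\<close> of the warped product on lifted
  fields matters. A tangent vector of the product is determined by its two projections, and by
  nondegeneracy each projection is determined by its products with vector fields of the factor. The
  Koszul formula therefore gives \<open>\<nabla>\<^sub>X Y\<close> on lifts: it is the lift of \<open>\<nabla>\<^sup>1\<^sub>X Y\<close> on the first factor, it is
  \<open>(X f / f) Y\<close> for \<open>X\<close> on the first and \<open>Y\<close> on the second factor, and on the second factor it is the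
  lift of \<open>\<nabla>\<^sup>2\<^sub>X Y\<close> minus \<open>f g\<^sub>2(X, Y) grad f\<close>. The curvature follows from the axioms of a connection,
  because all coefficients are smooth functions on the product. That every derivation is a value of
  a smooth field, and that lifts are smooth, rests on the description of derivations in charts,
  which comes from Hadamard's lemma and cutoff functions.\<close>

section \<open>Calculus of smooth functions\<close>

text \<open>Two features of the definitions shape the proof. A connection acts on vector fields, not
  on single vectors, and a derivation sees only functions that are smooth on the whole manifold.
  Local data therefore have to be extended globally before any axiom applies, and the cutoffs serve
  this purpose. The gradient is a definite description, so its existence has to be proved. Inverting
  the matrix of the metric in charts is avoided: the gradient is read off from \<open>D\<close> on
  the product. This needs a vector of the second factor that is not null, found by polarization from
  nondegeneracy and a nonzero tangent vector. Likewise, that a Lie bracket is again a smooth field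
  is read off from vanishing torsion. The powers of \<open>f\<close> in the final formulas have two
  sources: the factor \<open>f^2\<close> of the metric on the second factor, and the coefficient
  \<open>f g2(Y, Z)\<close> of the gradient in the connection, which meets the logarithmic
  derivative \<open>X f / f\<close> when a second derivative is taken.\<close>

lemma frechet_derivative_cong_open:
  assumes "open S" "x \<in> S" "\<And>y. y \<in> S \<Longrightarrow> f y = g y"
  shows "frechet_derivative f (at x) = frechet_derivative g (at x)"
proof -
  have "(f has_derivative f') (at x) \<longleftrightarrow> (g has_derivative f') (at x)" for f'
    using assms has_derivative_transform_within_open[of f f' x UNIV S g]
      has_derivative_transform_within_open[of g f' x UNIV S f] by auto
  then show ?thesis by (simp add: frechet_derivative_def)
qed

lemma differentiable_cong_open:
  assumes "open S" "x \<in> S" "\<And>y. y \<in> S \<Longrightarrow> f y = g y"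
  shows "f differentiable (at x) \<longleftrightarrow> g differentiable (at x)"
proof -
  have "(f has_derivative f') (at x) \<longleftrightarrow> (g has_derivative f') (at x)" for f'
    using assms has_derivative_transform_within_open[of f f' x UNIV S g]
      has_derivative_transform_within_open[of g f' x UNIV S f] by auto
  then show ?thesis by (simp add: differentiable_def)
qed

lemma Ck_on_cong:
  assumes "open S" "\<And>x. x \<in> S \<Longrightarrow> f x = g x"
  shows "Ck_on k f S \<longleftrightarrow> Ck_on k g S"
  using assms(2)
proof (induction k arbitrary: f g)
  case 0
  then show ?case by (simp cong: continuous_on_cong)
next
  case (Suc k)
  have "Ck_on k (\<lambda>x. frechet_derivative f (at x) v) S \<longleftrightarrow>
        Ck_on k (\<lambda>x. frechet_derivative g (at x) v) S" for v
    by (rule Suc.IH) (metis frechet_derivative_cong_open[OF \<open>open S\<close>] Suc.prems)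
  then show ?case
    using differentiable_cong_open[OF \<open>open S\<close> _ Suc.prems] by simp
qed

text \<open>Lets an explicit derivative formula stand in for \<open>frechet_derivative\<close>: the
  two agree on the open set \<open>S\<close>, and \<open>Ck_on_cong\<close> does the rest.\<close>

lemma Ck_on_SucI:
  assumes "open S" "\<And>x. x \<in> S \<Longrightarrow> (f has_derivative f' x) (at x)"
    and "\<And>v. Ck_on k (\<lambda>x. f' x v) S"
  shows "Ck_on (Suc k) f S"
proof -
  have "Ck_on k (\<lambda>x. frechet_derivative f (at x) v) S" for v
    using assms(3)[of v] frechet_derivative_at[OF assms(2)]
    by (subst Ck_on_cong[OF assms(1)]) auto
  then show ?thesis using assms(2) by (auto simp: differentiable_def)
qed

lemma Ck_on_mono: "Ck_on k f S \<Longrightarrow> T \<subseteq> S \<Longrightarrow> Ck_on k f T"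
  by (induction k arbitrary: f) (auto intro: continuous_on_subset)

lemma Ck_on_SucD: "Ck_on (Suc k) f S \<Longrightarrow> Ck_on k f S"
proof (induction k arbitrary: f)
  case 0
  then show ?case
    by (auto intro!: continuous_at_imp_continuous_on dest: differentiable_imp_continuous_within)
next
  case (Suc k)
  have "Ck_on k (\<lambda>x. frechet_derivative f (at x) v) S" for v
    by (rule Suc.IH) (use Suc.prems in \<open>simp only: Ck_on.simps(2)[of "Suc k"]\<close>)
  then show ?case using Suc.prems by (simp only: Ck_on.simps(2)) blast
qed

lemma Ck_on_Suc_has_derivative:
  "Ck_on (Suc k) f S \<Longrightarrow> x \<in> S \<Longrightarrow> (f has_derivative frechet_derivative f (at x)) (at x)"
  by (auto simp: frechet_derivative_works)

lemma Ck_on_Suc_frechet: "Ck_on (Suc k) f S \<Longrightarrow> Ck_on k (\<lambda>x. frechet_derivative f (at x) v) S"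
  by simp

text \<open>Both differentiability at a point and continuity are local, so local verification
  suffices at every order; this is what permits smoothness to be checked around one point at a
  time.\<close>

lemma Ck_on_Union:
  assumes "\<And>x. x \<in> S \<Longrightarrow> \<exists>W. open W \<and> x \<in> W \<and> Ck_on k f W"
  shows "Ck_on k f S"
  using assms
proof (induction k arbitrary: f)
  case 0
  then show ?case
    by (metis Ck_on.simps(1) continuous_at_imp_continuous_on continuous_on_eq_continuous_at)
next
  case (Suc k)
  have "Ck_on k (\<lambda>x. frechet_derivative f (at x) v) S" for v
    by (rule Suc.IH) (metis Suc.prems Ck_on.simps(2))
  moreover have "f differentiable (at x)" if "x \<in> S" for x
    using Suc.prems[OF that] by auto
  ultimately show ?case by simp
qed

lemma Ck_on_const: "Ck_on k (\<lambda>x. c) S"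
proof (induction k arbitrary: c)
  case (Suc k)
  then show ?case by simp
qed simp

lemma Ck_on_add:
  assumes "open S"
  shows "Ck_on k f S \<Longrightarrow> Ck_on k g S \<Longrightarrow> Ck_on k (\<lambda>x. f x + g x) S"
proof (induction k arbitrary: f g)
  case 0
  then show ?case by (simp add: continuous_on_add)
next
  case (Suc k)
  note d = Ck_on_Suc_has_derivative
  show ?case
    by (rule Ck_on_SucI[OF assms has_derivative_add[OF d[OF Suc.prems(1)] d[OF Suc.prems(2)]]])
      (assumption | rule Suc.IH Suc.prems[THEN Ck_on_Suc_frechet])+
qed

lemma Ck_on_sum:
  assumes "open S" "\<And>i. i \<in> I \<Longrightarrow> Ck_on k (f i) S"
  shows "Ck_on k (\<lambda>x. \<Sum>i\<in>I. f i x) S"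
  using assms(2)
  by (induction I rule: infinite_finite_induct) (auto intro!: Ck_on_const Ck_on_add[OF assms(1)])

text \<open>The product rule yields two terms of the same bilinear shape, each with one factor
  differentiated and the other not, so the induction also uses that order \<open>Suc k\<close>
  implies order \<open>k\<close>. Scaling, inner product and multiplication are all
  instances.\<close>

lemma Ck_on_bilinear:
  assumes "open S" "bounded_bilinear B"
  shows "Ck_on k f S \<Longrightarrow> Ck_on k g S \<Longrightarrow> Ck_on k (\<lambda>x. B (f x) (g x)) S"
proof (induction k arbitrary: f g)
  case 0
  then show ?case using bounded_bilinear.continuous_on[OF assms(2)] by simp
next
  case (Suc k)
  note d = Ck_on_Suc_has_derivative
  show ?case
    by (rule Ck_on_SucI[OF assms(1) bounded_bilinear.FDERIV[OF assms(2) d[OF Suc.prems(1)] d[OF Suc.prems(2)]]])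
      (assumption | intro Ck_on_add[OF assms(1)] Suc.IH Suc.prems[THEN Ck_on_SucD] Suc.prems[THEN Ck_on_Suc_frechet])+
qed

lemma Ck_on_bounded_linear:
  assumes "open S" "bounded_linear L"
  shows "Ck_on k f S \<Longrightarrow> Ck_on k (\<lambda>x. L (f x)) S"
proof (induction k arbitrary: f)
  case 0
  then show ?case using bounded_linear.continuous_on[OF assms(2)] by simp
next
  case (Suc k)
  show ?case
    by (rule Ck_on_SucI[OF assms(1) bounded_linear.has_derivative[OF assms(2) Ck_on_Suc_has_derivative[OF Suc.prems]]])
      (assumption | intro Suc.IH Suc.prems[THEN Ck_on_Suc_frechet])+
qed

lemma Ck_on_ident: "open S \<Longrightarrow> Ck_on k (\<lambda>x. x) S"
proof (cases k)
  case (Suc j)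
  assume "open S"
  then show ?thesis unfolding Suc
    by (intro Ck_on_SucI[OF _ has_derivative_ident] Ck_on_const) auto
qed (simp add: continuous_on_id)

lemma Ck_on_linear: "open S \<Longrightarrow> bounded_linear L \<Longrightarrow> Ck_on k L S"
  using Ck_on_bounded_linear[OF _ _ Ck_on_ident] by auto

text \<open>In the chain rule the derivative of \<open>g\<close> is taken in the direction
  \<open>?f x v\<close>, which moves with \<open>x\<close>, while \<open>Ck_on\<close> controls
  fixed directions only. Expanding that direction in the standard basis leaves fixed directions with
  smooth coefficients; this is where the finite dimension of the middle space enters.\<close>

lemma Ck_on_compose:
  fixes f :: "'a::real_normed_vector \<Rightarrow> 'e::euclidean_space"
    and g :: "'e \<Rightarrow> 'c::real_normed_vector"
  assumes "open S" "open T" "f ` S \<subseteq> T"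
  shows "Ck_on k f S \<Longrightarrow> Ck_on k g T \<Longrightarrow> Ck_on k (\<lambda>x. g (f x)) S"
  using assms(3)
proof (induction k arbitrary: g)
  case 0
  then show ?case by (auto intro: continuous_on_compose2)
next
  case (Suc k)
  let ?f = "\<lambda>x. frechet_derivative f (at x)" and ?g = "\<lambda>x. frechet_derivative g (at x)"
  have der: "((\<lambda>x. g (f x)) has_derivative (\<lambda>v. \<Sum>b\<in>Basis. (?f x v \<bullet> b) *\<^sub>R ?g (f x) b)) (at x)"
    if "x \<in> S" for x
  proof -
    have g': "(g has_derivative ?g (f x)) (at (f x))"
      using Ck_on_Suc_has_derivative[OF Suc.prems(2)] Suc.prems(3) that by blast
    interpret linear "?g (f x)" by (rule has_derivative_linear) fact
    have "?g (f x) w = (\<Sum>b\<in>Basis. (w \<bullet> b) *\<^sub>R ?g (f x) b)" for w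
      using arg_cong[OF euclidean_representation[of w, symmetric], of "?g (f x)"]
      by (simp only: sum scale)
    then have "(\<lambda>v. ?g (f x) (?f x v)) = (\<lambda>v. \<Sum>b\<in>Basis. (?f x v \<bullet> b) *\<^sub>R ?g (f x) b)"
      by blast
    then show ?thesis
      using has_derivative_compose[OF Ck_on_Suc_has_derivative[OF Suc.prems(1) that] g']
      by (simp only:)
  qed
  have "Ck_on k (\<lambda>x. \<Sum>b\<in>Basis. (?f x v \<bullet> b) *\<^sub>R ?g (f x) b) S" for v
    by (intro Ck_on_sum[OF assms(1)] Ck_on_bilinear[OF assms(1) bounded_bilinear_scaleR])
      (rule Ck_on_bounded_linear[OF assms(1) bounded_linear_inner_left Suc.prems(1)[THEN Ck_on_Suc_frechet]]
        Suc.IH[OF Ck_on_SucD[OF Suc.prems(1)] Suc.prems(2)[THEN Ck_on_Suc_frechet] Suc.prems(3)])+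
  with der show ?case
    by (rule Ck_on_SucI[OF assms(1)])
qed

lemma Ck_on_Pair:
  assumes "open S" "Ck_on k f S" "Ck_on k g S"
  shows "Ck_on k (\<lambda>x. (f x, g x)) S"
proof -
  have "Ck_on k (\<lambda>x. (f x, 0) + (0, g x)) S"
    by (intro Ck_on_add Ck_on_bounded_linear[where L = "\<lambda>y. (y, 0)"]
        Ck_on_bounded_linear[where L = "\<lambda>y. (0, y)"] assms bounded_linear_Pair
        bounded_linear_ident bounded_linear_zero)
  then show ?thesis by simp
qed

text \<open>The derivative of \<open>1/f\<close> is again a product of copies of \<open>1/f\<close>
  and a derivative of \<open>f\<close>, so the induction closes without treating higher
  powers.\<close>

lemma Ck_on_inverse:
  fixes f :: "'a::real_normed_vector \<Rightarrow> real"
  assumes "open S" "\<And>x. x \<in> S \<Longrightarrow> f x \<noteq> 0"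
  shows "Ck_on k f S \<Longrightarrow> Ck_on k (\<lambda>x. inverse (f x)) S"
proof (induction k)
  case 0
  then show ?case using assms by (auto intro: continuous_on_inverse)
next
  case (Suc k)
  have der: "((\<lambda>x. inverse (f x)) has_derivative
     (\<lambda>v. (- 1) * ((inverse (f x) * frechet_derivative f (at x) v) * inverse (f x)))) (at x)"
    if "x \<in> S" for x
    using Deriv.has_derivative_inverse[OF assms(2)[OF that] Ck_on_Suc_has_derivative[OF Suc.prems that]]
    by simp
  show ?case
    by (rule Ck_on_SucI[OF assms(1) der])
      (assumption | intro Ck_on_bilinear[OF assms(1) bounded_bilinear_mult] Ck_on_const
          Suc.IH[OF Suc.prems[THEN Ck_on_SucD]] Suc.prems[THEN Ck_on_Suc_frechet])+
qed

section \<open>Smoothness of all orders on open sets\<close>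

lemma smooth_on_cong: "open S \<Longrightarrow> (\<And>x. x \<in> S \<Longrightarrow> f x = g x) \<Longrightarrow> smooth_on S f \<longleftrightarrow> smooth_on S g"
  using Ck_on_cong[of S f g] by (auto simp: smooth_on_def)

lemma smooth_on_mono: "smooth_on S f \<Longrightarrow> T \<subseteq> S \<Longrightarrow> smooth_on T f"
  by (auto simp: smooth_on_def intro: Ck_on_mono)

lemma smooth_on_Union:
  "(\<And>x. x \<in> S \<Longrightarrow> \<exists>W. open W \<and> x \<in> W \<and> smooth_on W f) \<Longrightarrow> smooth_on S f"
  unfolding smooth_on_def by (intro allI Ck_on_Union) meson

lemma smooth_on_const: "smooth_on S (\<lambda>x. c)"
  by (simp add: smooth_on_def Ck_on_const)

lemma smooth_on_add: "open S \<Longrightarrow> smooth_on S f \<Longrightarrow> smooth_on S g \<Longrightarrow> smooth_on S (\<lambda>x. f x + g x)"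
  by (simp add: smooth_on_def Ck_on_add)

lemma smooth_on_sum:
  "open S \<Longrightarrow> (\<And>i. i \<in> I \<Longrightarrow> smooth_on S (f i)) \<Longrightarrow> smooth_on S (\<lambda>x. \<Sum>i\<in>I. f i x)"
  by (simp add: smooth_on_def Ck_on_sum)

lemma smooth_on_mult:
  fixes f g :: "'a::real_normed_vector \<Rightarrow> real"
  shows "open S \<Longrightarrow> smooth_on S f \<Longrightarrow> smooth_on S g \<Longrightarrow> smooth_on S (\<lambda>x. f x * g x)"
  by (simp add: smooth_on_def Ck_on_bilinear[OF _ bounded_bilinear_mult])

lemma smooth_on_linear: "open S \<Longrightarrow> bounded_linear L \<Longrightarrow> smooth_on S L"
  by (simp add: smooth_on_def Ck_on_linear)

lemma smooth_on_ident: "open S \<Longrightarrow> smooth_on S (\<lambda>x. x)"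
  by (simp add: smooth_on_def Ck_on_ident)

lemma smooth_on_compose:
  fixes f :: "'a::real_normed_vector \<Rightarrow> 'e::euclidean_space"
  shows "open S \<Longrightarrow> open T \<Longrightarrow> f ` S \<subseteq> T \<Longrightarrow> smooth_on S f \<Longrightarrow> smooth_on T g \<Longrightarrow>
    smooth_on S (\<lambda>x. g (f x))"
  by (simp add: smooth_on_def Ck_on_compose)

lemma smooth_on_Pair:
  "open S \<Longrightarrow> smooth_on S f \<Longrightarrow> smooth_on S g \<Longrightarrow> smooth_on S (\<lambda>x. (f x, g x))"
  by (simp add: smooth_on_def Ck_on_Pair)

lemma smooth_on_inverse:
  fixes f :: "'a::real_normed_vector \<Rightarrow> real"
  shows "open S \<Longrightarrow> (\<And>x. x \<in> S \<Longrightarrow> f x \<noteq> 0) \<Longrightarrow> smooth_on S f \<Longrightarrow> smooth_on S (\<lambda>x. inverse (f x))"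
  by (simp add: smooth_on_def Ck_on_inverse)

lemma smooth_on_frechet_derivative:
  "smooth_on S f \<Longrightarrow> smooth_on S (\<lambda>x. frechet_derivative f (at x) v)"
  unfolding smooth_on_def by (metis Ck_on.simps(2))

lemma smooth_on_has_derivative:
  "smooth_on S f \<Longrightarrow> x \<in> S \<Longrightarrow> (f has_derivative frechet_derivative f (at x)) (at x)"
  unfolding smooth_on_def by (metis Ck_on_Suc_has_derivative)

lemma smooth_on_continuous_on: "smooth_on S f \<Longrightarrow> continuous_on S f"
  unfolding smooth_on_def by (metis Ck_on.simps(1))

section \<open>Bump functions and Hadamard's lemma\<close>

text \<open>The factor \<open>inverse t ^ m\<close> makes the family closed under differentiation:
  every derivative of \<open>exp (-1/t)\<close> is a combination of its members. Smoothness then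
  follows by one induction for all \<open>m\<close> at once.\<close>

definition flat :: "nat \<Rightarrow> real \<Rightarrow> real" where
  "flat m t = (if t > 0 then exp (- inverse t) * inverse t ^ m else 0)"

text \<open>From the right, substitute \<open>s = 1/t\<close>: the exponential beats every power as
  \<open>s\<close> tends to infinity. From the left the function is zero.\<close>

lemma flat_tendsto_0: "(flat m \<longlongrightarrow> 0) (at 0)"
proof -
  have "((\<lambda>t::real. (inverse t) ^ m / exp (inverse t)) \<longlongrightarrow> 0) (at_right 0)"
    by (rule filterlim_compose[OF tendsto_power_div_exp_0 filterlim_inverse_at_top_right])
  moreover have "\<forall>\<^sub>F t in at_right 0. inverse t ^ m / exp (inverse t) = flat m t"
    by (auto simp: eventually_at_right_field flat_def exp_minus field_simps intro!: exI[of _ 1])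
  ultimately have "(flat m \<longlongrightarrow> 0) (at_right 0)"
    by (rule Lim_transform_eventually)
  moreover have "(flat m \<longlongrightarrow> 0) (at_left 0)"
    by (rule Lim_transform_eventually[OF tendsto_const])
      (auto simp: eventually_at_left_field flat_def intro!: exI[of _ "-1"])
  ultimately show ?thesis by (simp add: filterlim_at_split)
qed

lemma flat_has_field_derivative:
  "(flat m has_field_derivative flat (m + 2) t - real m * flat (m + 1) t) (at t)"
proof -
  consider "t > 0" | "t < 0" | "t = 0" by linarith
  then show ?thesis
  proof cases
    case 1
    have p: "((\<lambda>t. inverse t ^ m) has_field_derivative - (real m * inverse t ^ (m + 1))) (at t)"
    proof (cases m)
      case (Suc n)
      show ?thesis
        using 1 DERIV_power_Suc[OF DERIV_inverse, of t n] unfolding Suc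
        by (auto elim!: DERIV_cong simp: power2_eq_square algebra_simps)
    qed simp
    have e: "((\<lambda>t. exp (- inverse t)) has_field_derivative exp (- inverse t) * inverse t ^ 2) (at t)"
      using 1 by (auto intro!: derivative_eq_intros simp: power2_eq_square field_simps)
    have "((\<lambda>t. exp (- inverse t) * inverse t ^ m) has_field_derivative
       flat (m + 2) t - real m * flat (m + 1) t) (at t)"
      by (rule DERIV_cong[OF DERIV_mult[OF e p]]) (use 1 in \<open>simp add: flat_def power_add power2_eq_square algebra_simps\<close>)
    then show ?thesis
      by (rule has_field_derivative_transform_within_open[where S = "{0<..}"])
        (use 1 in \<open>auto simp: flat_def\<close>)
  next
    case 2
    have "((\<lambda>t. 0) has_field_derivative flat (m + 2) t - real m * flat (m + 1) t) (at t)"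
      using 2 by (auto simp: flat_def)
    then show ?thesis
      by (rule has_field_derivative_transform_within_open[where S = "{..<0}"])
        (use 2 in \<open>auto simp: flat_def\<close>)
  next
    case 3
    \<comment> \<open>At the origin the difference quotient is itself a member of the family, so its
      limit is already known to be 0, which is also the value of the claimed derivative
      there.\<close>
    have "(\<lambda>h. (flat m (0 + h) - flat m 0) / h) = flat (m + 1)"
      by (auto simp: flat_def fun_eq_iff field_simps)
    then show ?thesis using flat_tendsto_0[of "m + 1"] 3
      by (simp add: DERIV_def) (simp add: flat_def)
  qed
qed

lemma Ck_on_flat: "Ck_on k (flat m) UNIV"
proof (induction k arbitrary: m)
  case 0
  show ?case
    by (auto intro!: continuous_at_imp_continuous_on intro: DERIV_isCont[OF flat_has_field_derivative])
next
  case (Suc k)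
  have "Ck_on k (\<lambda>t. flat (m + 2) t * v + flat (m + 1) t * (- real m * v)) UNIV" for v
    by (intro Ck_on_add Ck_on_bilinear[OF _ bounded_bilinear_mult] Suc.IH Ck_on_const open_UNIV)
  moreover have "(flat m has_derivative (\<lambda>v. flat (m + 2) t * v + flat (m + 1) t * (- real m * v))) (at t)"
    for t
    using flat_has_field_derivative[of m t] unfolding has_field_derivative_def
    by (rule has_derivative_eq_rhs) (simp add: fun_eq_iff algebra_simps)
  ultimately show ?case by (intro Ck_on_SucI) auto
qed

lemma smooth_bump:
  fixes a :: "'e::euclidean_space"
  assumes "r > 0"
  obtains \<beta> :: "'e \<Rightarrow> real" where "smooth_on UNIV \<beta>" "\<And>x. x \<in> ball a r \<Longrightarrow> \<beta> x = 1"
    "\<And>x. x \<notin> ball a (2 * r) \<Longrightarrow> \<beta> x = 0"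
proof -
  \<comment> \<open>The quadratic \<open>s\<close> is 2 at the centre, 1 at distance
    \<open>r\<close> and -2 at distance \<open>2 r\<close>. The quotient \<beta> equals 1 where
    \<open>s \<ge> 1\<close> and 0 where \<open>s \<le> 0\<close>. Its denominator never vanishes,
    since \<open>t\<close> and \<open>1 - t\<close> cannot both be nonpositive.\<close>
  define s :: "'e \<Rightarrow> real" where "s x = 2 + (- inverse (r\<^sup>2)) * ((x - a) \<bullet> (x - a))" for x
  define \<beta> where "\<beta> x = flat 0 (s x) * inverse (flat 0 (s x) + flat 0 (1 + (-1) * s x))" for x
  have flat: "smooth_on UNIV (flat 0)" by (simp add: smooth_on_def Ck_on_flat)
  have "smooth_on UNIV (\<lambda>x::'e. x + (- a))"
    by (intro smooth_on_add smooth_on_ident smooth_on_const open_UNIV)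
  then have "smooth_on UNIV (\<lambda>x. (x - a) \<bullet> (x - a))"
    by (simp add: smooth_on_def Ck_on_bilinear[OF _ bounded_bilinear_inner])
  then have s: "smooth_on UNIV s" unfolding s_def
    by (intro smooth_on_add smooth_on_mult smooth_on_const open_UNIV)
  then have s': "smooth_on UNIV (\<lambda>x. 1 + (-1) * s x)"
    by (intro smooth_on_add smooth_on_mult smooth_on_const open_UNIV)
  have "flat 0 t + flat 0 (1 + (-1) * t) > 0" for t
    by (cases "t > 0") (auto simp: flat_def add_pos_pos)
  then have "smooth_on UNIV \<beta>" unfolding \<beta>_def
    by (intro smooth_on_mult smooth_on_inverse smooth_on_add
        smooth_on_compose[OF _ _ _ s flat] smooth_on_compose[OF _ _ _ s' flat]) (auto simp: less_le)
  moreover have "\<beta> x = 1" if "x \<in> ball a r" for x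
  proof -
    have "(x - a) \<bullet> (x - a) \<le> r\<^sup>2"
      using that power_mono[of "norm (x - a)" r 2]
      by (metis dist_commute dist_norm mem_ball less_imp_le norm_ge_zero power2_norm_eq_inner)
    then have "s x \<ge> 1" using assms by (simp add: s_def divide_simps)
    then show ?thesis by (simp add: \<beta>_def flat_def)
  qed
  moreover have "\<beta> x = 0" if "x \<notin> ball a (2 * r)" for x
  proof -
    have "(2 * r)\<^sup>2 \<le> (norm (x - a))\<^sup>2"
      using that assms by (intro power_mono) (auto simp: dist_norm norm_minus_commute)
    then have "4 * r\<^sup>2 \<le> (x - a) \<bullet> (x - a)"
      by (simp add: power2_norm_eq_inner power_mult_distrib)
    then have "2 * r\<^sup>2 \<le> (x - a) \<bullet> (x - a)"
      using zero_le_power2[of r] by linarith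
    then have "s x \<le> 0" using assms by (simp add: s_def divide_simps)
    then show ?thesis by (simp add: \<beta>_def flat_def)
  qed
  ultimately show ?thesis using that by blast
qed

lemma segment_mem_ball:
  fixes a :: "'e::real_normed_vector"
  assumes "x \<in> ball a r" "t \<in> {0..1}"
  shows "a + t *\<^sub>R (x - a) \<in> ball a r"
proof -
  have "t * norm (x - a) \<le> norm (x - a)" using assms(2) by (auto intro: mult_left_le_one_le)
  then show ?thesis using assms by (auto simp: dist_norm norm_minus_commute)
qed

lemma continuous_on_segment_map:
  fixes F :: "'e::euclidean_space \<Rightarrow> real"
  assumes "continuous_on (ball a r) F"
  shows "continuous_on (ball a r \<times> {0..1}) (\<lambda>(x, t). t ^ m * F (a + t *\<^sub>R (x - a)))"
proof -
  have "continuous_on (ball a r \<times> {0..1}) (\<lambda>z. F (a + snd z *\<^sub>R (fst z - a)))"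
    by (rule continuous_on_compose2[OF assms])
      (auto intro!: continuous_intros segment_mem_ball simp del: mem_ball)
  then show ?thesis unfolding split_beta by (intro continuous_intros)
qed

text \<open>Since differentiating under the integral in \<open>x\<close> produces the same kind of integral with one
  more factor \<open>t\<close>, an induction over \<open>k\<close> for all \<open>m\<close> gives smoothness.\<close>

lemma Ck_on_integral_segment:
  fixes F :: "'e::euclidean_space \<Rightarrow> real"
  assumes "smooth_on (ball a r) F"
  shows "Ck_on k (\<lambda>x. integral {0..1} (\<lambda>t. t ^ m * F (a + t *\<^sub>R (x - a)))) (ball a r)"
  using assms
proof (induction k arbitrary: F m)
  case 0
  have "continuous_on (ball a r) (\<lambda>x. integral (cbox 0 1) (\<lambda>t. t ^ m * F (a + t *\<^sub>R (x - a))))"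
    by (rule integral_continuous_on_param)
      (use continuous_on_segment_map[OF smooth_on_continuous_on[OF 0]] in simp)
  then show ?case by simp
next
  case (Suc k)
  let ?D = "\<lambda>x. frechet_derivative F (at x)"
  \<comment> \<open>The derivative of the integrand in \<open>x\<close>, packed as a bounded linear
    function because the Leibniz rule asks for that type. The extra factor \<open>t\<close> is the
    inner derivative of \<open>a + t (x - a)\<close>.\<close>
  define L where "L x t = Blinfun (\<lambda>v. t ^ Suc m * ?D (a + t *\<^sub>R (x - a)) v)" for x and t :: real
  note seg = segment_mem_ball
  have L: "blinfun_apply (L x t) v = t ^ Suc m * ?D (a + t *\<^sub>R (x - a)) v"
    if "x \<in> ball a r" "t \<in> {0..1}" for x t v
    unfolding L_def using smooth_on_has_derivative[OF Suc.prems seg[OF that]]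
    by (subst bounded_linear_Blinfun_apply)
      (auto intro: bounded_linear_const_mult dest: has_derivative_bounded_linear simp del: power_Suc)
  have "((\<lambda>x. integral (cbox 0 1) (\<lambda>t. t ^ m * F (a + t *\<^sub>R (x - a)))) has_derivative
      integral (cbox 0 1) (L x)) (at x within ball a r)" if "x \<in> ball a r" for x
  proof (rule leibniz_rule[OF _ _ _ that convex_ball])
    fix x and t :: real assume xt: "x \<in> ball a r" "t \<in> cbox 0 1"
    have "((\<lambda>x. a + t *\<^sub>R (x - a)) has_derivative (\<lambda>v. t *\<^sub>R v)) (at x within ball a r)"
      by (auto intro!: derivative_eq_intros)
    from has_derivative_compose[OF this smooth_on_has_derivative[OF Suc.prems seg[OF xt[unfolded cbox_interval]]]]
    have "((\<lambda>x. t ^ m * F (a + t *\<^sub>R (x - a))) has_derivative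
      (\<lambda>v. t ^ m * ?D (a + t *\<^sub>R (x - a)) (t *\<^sub>R v))) (at x within ball a r)"
      using xt by (intro has_derivative_mult_right) auto
    also have "(\<lambda>v. t ^ m * ?D (a + t *\<^sub>R (x - a)) (t *\<^sub>R v)) = blinfun_apply (L x t)"
      using xt linear_scale[OF has_derivative_linear[OF smooth_on_has_derivative[OF Suc.prems seg]], of x t t]
      by (auto simp: L fun_eq_iff)
    finally show "((\<lambda>x. t ^ m * F (a + t *\<^sub>R (x - a))) has_derivative blinfun_apply (L x t))
      (at x within ball a r)" .
  next
    fix x assume "x \<in> ball a r"
    then show "(\<lambda>t. t ^ m * F (a + t *\<^sub>R (x - a))) integrable_on cbox 0 1"
      by (intro integrable_continuous)
        (rule continuous_on_compose2[OF continuous_on_segment_map[OF smooth_on_continuous_on[OF Suc.prems]],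
            where f = "Pair x", unfolded split_beta fst_conv snd_conv];
          auto intro!: continuous_intros)
  next
    have "continuous_on (ball a r \<times> {0..1}) (\<lambda>z. blinfun_apply (L (fst z) (snd z)) i)" for i
      using continuous_on_segment_map[OF smooth_on_continuous_on[OF smooth_on_frechet_derivative[OF Suc.prems, of i]], of "Suc m"]
      by (rule continuous_on_cong[OF refl, THEN iffD1, rotated]) (auto simp: L)
    then show "continuous_on (ball a r \<times> cbox 0 1) (\<lambda>(x, t). L x t)"
      unfolding split_beta by (intro continuous_on_blinfun_componentwise) simp
  qed
  then have der: "((\<lambda>x. integral {0..1} (\<lambda>t. t ^ m * F (a + t *\<^sub>R (x - a)))) has_derivative
      integral {0..1} (L x)) (at x)" if "x \<in> ball a r" for x
    using that by (simp add: at_within_open[OF _ open_ball] del: mem_ball)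
  \<comment> \<open>In a fixed direction \<open>v\<close> the derivative is an integral of the
    original form, with exponent \<open>Suc m\<close> and with \<open>F\<close> replaced by its
    derivative along \<open>v\<close>; the induction hypothesis is stated for exactly such
    integrals.\<close>
  have ev: "blinfun_apply (integral {0..1} (L x)) v =
      integral {0..1} (\<lambda>t. t ^ Suc m * ?D (a + t *\<^sub>R (x - a)) v)" if "x \<in> ball a r" for x v
  proof -
    have "continuous_on {0..1} (\<lambda>t. blinfun_apply (L x t) i)" for i
    proof -
      have "continuous_on {0..1} (\<lambda>t. t ^ Suc m * ?D (a + t *\<^sub>R (x - a)) i)"
        by (rule continuous_on_compose2[OF continuous_on_segment_map[OF smooth_on_continuous_on[OF
                smooth_on_frechet_derivative[OF Suc.prems, of i]], of "Suc m"],
            where f = "Pair x", unfolded split_beta fst_conv snd_conv])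
          (use that in \<open>auto intro!: continuous_intros\<close>)
      then show ?thesis
        by (rule continuous_on_cong[OF refl, THEN iffD1, rotated]) (use that in \<open>auto simp: L\<close>)
    qed
    then have "L x integrable_on {0..1}"
      by (intro integrable_continuous_interval continuous_on_blinfun_componentwise)
    then have "blinfun_apply (integral {0..1} (L x)) v = integral {0..1} (\<lambda>t. blinfun_apply (L x t) v)"
      by (rule blinfun_apply_integral)
    also have "\<dots> = integral {0..1} (\<lambda>t. t ^ Suc m * ?D (a + t *\<^sub>R (x - a)) v)"
      by (rule integral_cong) (use that in \<open>simp add: L\<close>)
    finally show ?thesis .
  qed
  have "Ck_on k (\<lambda>x. blinfun_apply (integral {0..1} (L x)) v) (ball a r)" for v
    using Suc.IH[OF smooth_on_frechet_derivative[OF Suc.prems], of "Suc m" v]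
    by (rule Ck_on_cong[OF open_ball, THEN iffD1, rotated]) (simp only: ev)
  with der show ?case by (rule Ck_on_SucI[OF open_ball])
qed

text \<open>Integrate the derivative of \<open>F\<close> along the segment from \<open>a\<close> to
  \<open>x\<close> and expand the direction \<open>x - a\<close> in the basis. The function
  \<open>G b\<close> is the mean of the partial derivative along \<open>b\<close> over the segment,
  so at \<open>a\<close> it is that derivative itself.\<close>

lemma Hadamard:
  fixes F :: "'e::euclidean_space \<Rightarrow> real"
  assumes "smooth_on (ball a r) F"
  obtains G where "\<And>b. smooth_on (ball a r) (G b)" "\<And>b. G b a = frechet_derivative F (at a) b"
    "\<And>x. x \<in> ball a r \<Longrightarrow> F x = F a + (\<Sum>b\<in>Basis. ((x - a) \<bullet> b) * G b x)"
proof
  let ?D = "\<lambda>x. frechet_derivative F (at x)"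
  \<comment> \<open>The factor \<open>t ^ 0\<close> only brings the integrand into the form of
    \<open>Ck_on_integral_segment\<close>.\<close>
  let ?G = "\<lambda>b x. integral {0..1} (\<lambda>t. t ^ 0 * ?D (a + t *\<^sub>R (x - a)) b)"
  note sm = smooth_on_frechet_derivative[OF assms]
  show "smooth_on (ball a r) (?G b)" for b
    unfolding smooth_on_def using Ck_on_integral_segment[OF sm] by blast
  show "?G b a = ?D a b" for b by simp
  show "F x = F a + (\<Sum>b\<in>Basis. ((x - a) \<bullet> b) * ?G b x)" if x: "x \<in> ball a r" for x
  proof -
    have "((\<lambda>t. F (a + t *\<^sub>R (x - a))) has_vector_derivative ?D (a + t *\<^sub>R (x - a)) (x - a))
        (at t within {0..1})" if "t \<in> {0..1}" for t
    proof -
      have "((\<lambda>t. a + t *\<^sub>R (x - a)) has_derivative (\<lambda>s. s *\<^sub>R (x - a))) (at t within {0..1})"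
        by (auto intro!: derivative_eq_intros)
      from has_derivative_compose[OF this smooth_on_has_derivative[OF assms segment_mem_ball[OF x that]]]
      show ?thesis
        using linear_scale[OF has_derivative_linear[OF smooth_on_has_derivative[OF assms segment_mem_ball[OF x that]]]]
        by (simp add: has_vector_derivative_def)
    qed
    then have "((\<lambda>t. ?D (a + t *\<^sub>R (x - a)) (x - a)) has_integral
        F (a + 1 *\<^sub>R (x - a)) - F (a + 0 *\<^sub>R (x - a))) {0..1}"
      by (intro fundamental_theorem_of_calculus) auto
    then have 1: "integral {0..1} (\<lambda>t. ?D (a + t *\<^sub>R (x - a)) (x - a)) = F x - F a"
      by (simp add: integral_unique)
    have lin: "?D y w = (\<Sum>b\<in>Basis. (w \<bullet> b) * ?D y b)" if "y \<in> ball a r" for y w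
    proof -
      interpret linear "?D y" by (rule has_derivative_linear[OF smooth_on_has_derivative[OF assms that]])
      show ?thesis
        using arg_cong[OF euclidean_representation[of w, symmetric], of "?D y"]
        by (simp only: sum scale real_scaleR_def)
    qed
    have "integral {0..1} (\<lambda>t. ?D (a + t *\<^sub>R (x - a)) (x - a)) =
      integral {0..1} (\<lambda>t. \<Sum>b\<in>Basis. ((x - a) \<bullet> b) * ?D (a + t *\<^sub>R (x - a)) b)"
      by (rule integral_cong) (rule lin[OF segment_mem_ball[OF x]])
    also have "\<dots> = (\<Sum>b\<in>Basis. integral {0..1} (\<lambda>t. ((x - a) \<bullet> b) * ?D (a + t *\<^sub>R (x - a)) b))"
    proof (rule integral_sum)
      fix b :: 'e
      have "continuous_on {0..1} (\<lambda>t. t ^ 0 * ?D (a + t *\<^sub>R (x - a)) b)"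
        by (rule continuous_on_compose2[OF continuous_on_segment_map[OF smooth_on_continuous_on[OF sm, of b], of 0],
            where f = "Pair x", unfolded split_beta fst_conv snd_conv])
          (use x in \<open>auto intro!: continuous_intros\<close>)
      then show "(\<lambda>t. ((x - a) \<bullet> b) * ?D (a + t *\<^sub>R (x - a)) b) integrable_on {0..1}"
        by (intro integrable_continuous_interval continuous_intros) simp
    qed simp
    finally show ?thesis using 1 by simp
  qed
qed

section \<open>Tangent vectors and vector fields\<close>

lemma chartD:
  assumes "smooth_manifold A" "(U, \<phi>) \<in> A"
  shows "open U" "open (\<phi> ` U)" "inj_on \<phi> U" "continuous_on U \<phi>"
    "continuous_on (\<phi> ` U) (inv_into U \<phi>)"
proof -
  have "is_chart (U, \<phi>)" using assms by (auto simp: smooth_manifold_def)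
  then show "open U" "open (\<phi> ` U)" "inj_on \<phi> U" "continuous_on U \<phi>"
    "continuous_on (\<phi> ` U) (inv_into U \<phi>)"
    by (auto simp: is_chart_def homeomorphism_def)
qed

lemma chart_open_image:
  assumes "smooth_manifold A" "(U, \<phi>) \<in> A" "open N" "N \<subseteq> U"
  shows "open (\<phi> ` N)"
proof -
  note c = chartD[OF assms(1,2)]
  have "\<phi> ` N = inv_into U \<phi> -` N \<inter> \<phi> ` U"
    using assms(4) c(3) by (auto simp: inv_into_f_f f_inv_into_f subset_iff intro!: image_eqI)
  then show ?thesis
    using continuous_on_open_vimage[OF c(2)] c(5) assms(3) by metis
qed

lemma chart_cover:
  assumes "smooth_manifold A"
  obtains U \<phi> where "(U, \<phi>) \<in> A" "p \<in> U"
proof -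
  have "p \<in> (\<Union>(U, \<phi>)\<in>A. U)" using assms unfolding smooth_manifold_def by auto
  then show thesis using that by auto
qed

lemma smooth_funD: "smooth_fun A h \<Longrightarrow> (U, \<phi>) \<in> A \<Longrightarrow> smooth_on (\<phi> ` U) (h \<circ> inv_into U \<phi>)"
  by (auto simp: smooth_fun_def)

lemma chart_change:
  assumes A: "smooth_manifold A" and c: "(U, \<phi>) \<in> A" "(V, \<psi>) \<in> A"
    and N: "open N" "N \<subseteq> U" "N \<subseteq> V" and h: "smooth_on (\<phi> ` N) (h \<circ> inv_into U \<phi>)"
  shows "smooth_on (\<psi> ` N) (h \<circ> inv_into V \<psi>)"
proof -
  have "smooth_on (\<psi> ` (V \<inter> U)) (\<phi> \<circ> inv_into V \<psi>)"
    using A c unfolding smooth_manifold_def by blast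
  then have t: "smooth_on (\<psi> ` N) (\<phi> \<circ> inv_into V \<psi>)"
    by (rule smooth_on_mono) (use N in auto)
  note i = chartD(3)[OF A c(1)] chartD(3)[OF A c(2)]
  have inv: "inv_into V \<psi> (\<psi> x) = x" "inv_into U \<phi> (\<phi> x) = x" if "x \<in> N" for x
    using that N i by (auto simp: inv_into_f_f subset_iff)
  have "smooth_on (\<psi> ` N) (\<lambda>y. (h \<circ> inv_into U \<phi>) ((\<phi> \<circ> inv_into V \<psi>) y))"
    by (rule smooth_on_compose[OF _ _ _ t h])
      (use chart_open_image[OF A] c N inv in auto)
  then show ?thesis
    by (rule smooth_on_cong[OF chart_open_image[OF A c(2) N(1,3)], THEN iffD1, rotated])
      (auto simp: inv)
qed

text \<open>\<open>smooth_fun\<close> quantifies over all charts of the atlas. Here a single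
  convenient chart near each point is enough, because the transition maps carry smoothness to every
  other chart.\<close>

lemma smooth_fun_local:
  assumes A: "smooth_manifold A"
    and loc: "\<And>p. \<exists>U \<phi> N. (U, \<phi>) \<in> A \<and> open N \<and> p \<in> N \<and> N \<subseteq> U \<and>
      smooth_on (\<phi> ` N) (h \<circ> inv_into U \<phi>)"
  shows "smooth_fun A h"
  unfolding smooth_fun_def
proof (clarify)
  fix V \<psi> assume V: "(V, \<psi>) \<in> A"
  show "smooth_on (\<psi> ` V) (h \<circ> inv_into V \<psi>)"
  proof (rule smooth_on_Union)
    fix x assume "x \<in> \<psi> ` V"
    then obtain p where p: "p \<in> V" "x = \<psi> p" by auto
    obtain U \<phi> N where N: "(U, \<phi>) \<in> A" "open N" "p \<in> N" "N \<subseteq> U"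
      "smooth_on (\<phi> ` N) (h \<circ> inv_into U \<phi>)" using loc by blast
    have o: "open (N \<inter> V)" using N chartD(1)[OF A V] by auto
    have "smooth_on (\<psi> ` (N \<inter> V)) (h \<circ> inv_into V \<psi>)"
      by (rule chart_change[OF A N(1) V o]) (use N in \<open>auto elim!: smooth_on_mono\<close>)
    moreover have "open (\<psi> ` (N \<inter> V))" by (rule chart_open_image[OF A V o]) auto
    ultimately show "\<exists>W. open W \<and> x \<in> W \<and> smooth_on W (h \<circ> inv_into V \<psi>)"
      using p N by blast
  qed
qed

lemma smooth_fun_const: "smooth_fun A (\<lambda>x. c)"
  by (auto simp: smooth_fun_def o_def smooth_on_const)

lemma smooth_fun_add:
  assumes "smooth_manifold A" "smooth_fun A h" "smooth_fun A k"
  shows "smooth_fun A (\<lambda>x. h x + k x)"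
  using assms smooth_on_add[OF chartD(2)[OF assms(1)]]
  by (fastforce simp: smooth_fun_def o_def)

lemma smooth_fun_mult:
  assumes "smooth_manifold A" "smooth_fun A h" "smooth_fun A k"
  shows "smooth_fun A (\<lambda>x. h x * k x)"
  using assms smooth_on_mult[OF chartD(2)[OF assms(1)]]
  by (fastforce simp: smooth_fun_def o_def)

lemma smooth_fun_inverse:
  assumes "smooth_manifold A" "smooth_fun A h" "\<And>x. h x \<noteq> 0"
  shows "smooth_fun A (\<lambda>x. inverse (h x))"
  using assms smooth_on_inverse[OF chartD(2)[OF assms(1)]]
  by (fastforce simp: smooth_fun_def o_def)

lemma smooth_fun_diff:
  assumes "smooth_manifold A" "smooth_fun A h" "smooth_fun A k"
  shows "smooth_fun A (\<lambda>x. h x - k x)"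
  using smooth_fun_add[OF assms(1,2) smooth_fun_mult[OF assms(1) smooth_fun_const assms(3)], of "-1"]
  by simp

lemma smooth_fun_sum:
  assumes "smooth_manifold A" "\<And>i. i \<in> I \<Longrightarrow> smooth_fun A (h i)"
  shows "smooth_fun A (\<lambda>x. \<Sum>i\<in>I. h i x)"
  using assms(2)
  by (induction I rule: infinite_finite_induct)
    (auto intro: smooth_fun_const smooth_fun_add[OF assms(1)])

text \<open>The bridge from charts to the manifold: a function that is smooth only on
  \<open>N\<close> becomes globally smooth after multiplication by \<xi>, and is unchanged near
  \<open>p\<close>.\<close>

lemma cutoff:
  fixes A :: "('a::{t2_space, second_countable_topology}, 'e::euclidean_space) atlas"
  assumes A: "smooth_manifold A" and c: "(U, \<phi>) \<in> A" and N: "open N" "p \<in> N" "N \<subseteq> U"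
  obtains \<xi> W where "open W" "p \<in> W" "W \<subseteq> N" "\<And>x. x \<in> W \<Longrightarrow> \<xi> x = 1" "\<And>x. x \<notin> N \<Longrightarrow> \<xi> x = 0"
    "\<And>h. smooth_on (\<phi> ` N) (h \<circ> inv_into U \<phi>) \<Longrightarrow> smooth_fun A (\<lambda>x. \<xi> x * h x)"
proof -
  note ch = chartD[OF A c]
  have inv: "inv_into U \<phi> (\<phi> x) = x" if "x \<in> U" for x
    using that ch(3) by (simp add: inv_into_f_f)
  have oN: "open (\<phi> ` N)" by (rule chart_open_image[OF A c N(1,3)])
  then obtain R where R: "R > 0" "ball (\<phi> p) R \<subseteq> \<phi> ` N"
    using N(2) open_contains_ball by blast
  \<comment> \<open>With a third of \<open>R\<close>, the closed ball of radius \<open>2 r\<close>,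
    which contains the support of the bump, still lies in the open ball of radius
    \<open>R\<close>.\<close>
  define r where "r = R / 3"
  have r: "r > 0" "cball (\<phi> p) (2 * r) \<subseteq> \<phi> ` N"
    using R by (auto simp: r_def subset_iff)
  obtain \<beta> :: "'e \<Rightarrow> real" where \<beta>: "smooth_on UNIV \<beta>" "\<And>x. x \<in> ball (\<phi> p) r \<Longrightarrow> \<beta> x = 1"
    "\<And>x. x \<notin> ball (\<phi> p) (2 * r) \<Longrightarrow> \<beta> x = 0" using smooth_bump[OF r(1)] by blast
  define \<xi> where "\<xi> x = (if x \<in> N then \<beta> (\<phi> x) else 0)" for x
  \<comment> \<open>\<open>K\<close> is compact, hence closed because the manifold is Hausdorff. It
    lies in \<open>N\<close>, and \<xi> vanishes off it, so the open sets \<open>N\<close> and the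
    complement of \<open>K\<close> cover the manifold, and smoothness is clear on each.\<close>
  define K where "K = inv_into U \<phi> ` cball (\<phi> p) (2 * r)"
  have "continuous_on (cball (\<phi> p) (2 * r)) (inv_into U \<phi>)"
    by (rule continuous_on_subset[OF ch(5)]) (use r N in blast)
  then have "closed K" unfolding K_def by (intro compact_imp_closed compact_continuous_image) auto
  have \<xi>K: "\<xi> x = 0" if "x \<notin> K" for x
  proof (rule ccontr)
    assume nz: "\<xi> x \<noteq> 0"
    then have "x \<in> N" by (auto simp: \<xi>_def split: if_splits)
    then have "\<phi> x \<in> cball (\<phi> p) (2 * r)"
      using nz \<beta>(3)[of "\<phi> x"] by (fastforce simp: \<xi>_def)
    then have "inv_into U \<phi> (\<phi> x) \<in> K" by (auto simp: K_def)
    then show False using that inv \<open>x \<in> N\<close> N by auto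
  qed
  have KN: "K \<subseteq> N" using r(2) N inv by (force simp: K_def subset_iff image_iff)
  define W where "W = N \<inter> (\<phi> -` ball (\<phi> p) r \<inter> U)"
  have "open (\<phi> -` ball (\<phi> p) r \<inter> U)"
    using continuous_on_open_vimage[OF ch(1)] ch(4) open_ball by blast
  then have W: "open W" "p \<in> W" "W \<subseteq> N" "\<And>x. x \<in> W \<Longrightarrow> \<xi> x = 1"
    using N r \<beta>(2) by (auto simp: W_def \<xi>_def)
  have "smooth_fun A (\<lambda>x. \<xi> x * h x)" if h: "smooth_on (\<phi> ` N) (h \<circ> inv_into U \<phi>)" for h
  proof (rule smooth_fun_local[OF A])
    fix x
    show "\<exists>U \<phi> N. (U, \<phi>) \<in> A \<and> open N \<and> x \<in> N \<and> N \<subseteq> U \<and>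
      smooth_on (\<phi> ` N) ((\<lambda>x. \<xi> x * h x) \<circ> inv_into U \<phi>)"
    proof (cases "x \<in> N")
      case True
      have "smooth_on (\<phi> ` N) (\<lambda>y. \<beta> y * (h \<circ> inv_into U \<phi>) y)"
        by (intro smooth_on_mult oN h smooth_on_mono[OF \<beta>(1)]) auto
      then have "smooth_on (\<phi> ` N) ((\<lambda>x. \<xi> x * h x) \<circ> inv_into U \<phi>)"
        by (rule smooth_on_cong[OF oN, THEN iffD1, rotated])
          (use N inv in \<open>auto simp: \<xi>_def subset_iff\<close>)
      then show ?thesis using c N True by blast
    next
      case False
      obtain V \<psi> where V: "(V, \<psi>) \<in> A" "x \<in> V" using chart_cover[OF A] by metis
      have o: "open (V - K)" using \<open>closed K\<close> chartD(1)[OF A V(1)] by auto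
      have "smooth_on (\<psi> ` (V - K)) (\<lambda>y. 0 :: real)" by (rule smooth_on_const)
      then have "smooth_on (\<psi> ` (V - K)) ((\<lambda>x. \<xi> x * h x) \<circ> inv_into V \<psi>)"
        by (rule smooth_on_cong[OF chart_open_image[OF A V(1) o Diff_subset], THEN iffD1, rotated])
          (use chartD(3)[OF A V(1)] \<xi>K in \<open>auto simp: inv_into_f_f\<close>)
      then show ?thesis using V o False KN by (intro exI[of _ V] exI[of _ \<psi>] exI[of _ "V - K"]) auto
    qed
  qed
  moreover have "\<xi> x = 0" if "x \<notin> N" for x using that by (simp add: \<xi>_def)
  ultimately show thesis using that W by blast
qed

text \<open>A derivation has value 0 on functions that are not globally smooth, so it cannot be
  applied to the chart coordinates themselves; these are global substitutes that agree with them
  near \<open>p\<close>.\<close>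

lemma chart_coordinates:
  fixes A :: "('a::{t2_space, second_countable_topology}, 'e::euclidean_space) atlas"
  assumes A: "smooth_manifold A" and c: "(U, \<phi>) \<in> A" "p \<in> U"
  obtains W \<kappa> where "open W" "p \<in> W" "W \<subseteq> U" "\<And>b. smooth_fun A (\<kappa> b)"
    "\<And>b x. x \<in> W \<Longrightarrow> \<kappa> b x = \<phi> x \<bullet> b"
proof -
  note ch = chartD[OF A c(1)]
  obtain \<xi> W where W: "open W" "p \<in> W" "W \<subseteq> U" "\<And>x. x \<in> W \<Longrightarrow> \<xi> x = 1"
    "\<And>h. smooth_on (\<phi> ` U) (h \<circ> inv_into U \<phi>) \<Longrightarrow> smooth_fun A (\<lambda>x. \<xi> x * h x)"
    using cutoff[OF A c(1) ch(1) c(2) order_refl] by metis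
  have "smooth_on (\<phi> ` U) ((\<lambda>x. \<phi> x \<bullet> b) \<circ> inv_into U \<phi>)" for b
    using smooth_on_linear[OF ch(2) bounded_linear_inner_left[of b]]
    by (rule smooth_on_cong[OF ch(2), THEN iffD1, rotated]) (use ch(3) in auto)
  then show thesis using that[OF W(1-3), of "\<lambda>b x. \<xi> x * (\<phi> x \<bullet> b)"] W(4,5) by auto
qed

section \<open>Derivations and smooth vector fields\<close>

lemma tangent_spaceD:
  assumes "v \<in> tangent_space A p"
  shows "\<And>h. \<not> smooth_fun A h \<Longrightarrow> tapply v h = 0"
    "\<And>h k. smooth_fun A h \<Longrightarrow> smooth_fun A k \<Longrightarrow> tapply v (\<lambda>x. h x + k x) = tapply v h + tapply v k"
    "\<And>c h. smooth_fun A h \<Longrightarrow> tapply v (\<lambda>x. c * h x) = c * tapply v h"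
    "\<And>h k. smooth_fun A h \<Longrightarrow> smooth_fun A k \<Longrightarrow>
      tapply v (\<lambda>x. h x * k x) = h p * tapply v k + k p * tapply v h"
  using assms by (auto simp: tangent_space_def)

text \<open>The product rule for \<open>1 = 1 * 1\<close> gives \<open>v 1 = 2 * v 1\<close>, so
  \<open>v 1 = 0\<close>; homogeneity covers the other constants.\<close>

lemma tangent_vector_const:
  assumes "v \<in> tangent_space A p"
  shows "tapply v (\<lambda>x. c) = 0"
  using tangent_spaceD(4)[OF assms smooth_fun_const smooth_fun_const, of 1 1]
    tangent_spaceD(3)[OF assms smooth_fun_const, of c 1] by simp

lemma tangent_vector_diff:
  assumes "smooth_manifold A" "v \<in> tangent_space A p" "smooth_fun A h" "smooth_fun A k"
  shows "tapply v (\<lambda>x. h x - k x) = tapply v h - tapply v k"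
  using tangent_spaceD(2)[OF assms(2,3) smooth_fun_mult[OF assms(1) smooth_fun_const assms(4)], of "-1"]
    tangent_spaceD(3)[OF assms(2,4), of "-1"] by simp

lemma tangent_vector_sum:
  assumes "smooth_manifold A" "v \<in> tangent_space A p" "\<And>i. i \<in> I \<Longrightarrow> smooth_fun A (h i)"
  shows "tapply v (\<lambda>x. \<Sum>i\<in>I. h i x) = (\<Sum>i\<in>I. tapply v (h i))"
  using assms(3)
proof (induction I rule: infinite_finite_induct)
  case (insert i I)
  then show ?case
    using tangent_spaceD(2)[OF assms(2), of "h i" "\<lambda>x. \<Sum>i\<in>I. h i x"]
      smooth_fun_sum[OF assms(1), of I h] by simp
qed (auto simp: tangent_vector_const[OF assms(2)])

lemma tangent_vector_eqI:
  assumes "u \<in> tangent_space A p" "v \<in> tangent_space A p"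
    "\<And>h. smooth_fun A h \<Longrightarrow> tapply u h = tapply v h"
  shows "u = v"
  using assms tangent_spaceD(1) by (metis tapply_inject ext)

lemma tangent_space_zero: "0 \<in> tangent_space A p"
  by (simp add: tangent_space_def zero_tvec.rep_eq)

lemma tangent_space_add:
  "u \<in> tangent_space A p \<Longrightarrow> v \<in> tangent_space A p \<Longrightarrow> u + v \<in> tangent_space A p"
  unfolding tangent_space_def by (auto simp: plus_tvec.rep_eq algebra_simps)

lemma tangent_space_scaleR: "v \<in> tangent_space A p \<Longrightarrow> c *\<^sub>R v \<in> tangent_space A p"
  unfolding tangent_space_def by (auto simp: scaleR_tvec.rep_eq algebra_simps)

lemma tangent_space_diff:
  "u \<in> tangent_space A p \<Longrightarrow> v \<in> tangent_space A p \<Longrightarrow> u - v \<in> tangent_space A p"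
  using tangent_space_add[OF _ tangent_space_scaleR, of u A p v "-1"] by simp

lemma vector_field_tangent: "X \<in> vector_fields A \<Longrightarrow> X p \<in> tangent_space A p"
  by (simp add: vector_fields_def)

text \<open>For \<open>h\<close> not smooth, the convention that derivations vanish there makes the
  result the zero function, so no assumption on \<open>h\<close> is made.\<close>

lemma field_apply_smooth:
  assumes "X \<in> vector_fields A"
  shows "smooth_fun A (field_apply X h)"
proof (cases "smooth_fun A h")
  case False
  then have "field_apply X h = (\<lambda>p. 0)"
    using tangent_spaceD(1)[OF vector_field_tangent[OF assms]] by (auto simp: field_apply_def)
  then show ?thesis by (simp add: smooth_fun_const)
qed (use assms in \<open>auto simp: vector_fields_def\<close>)

lemma vector_fields_add:
  assumes "smooth_manifold A" "X \<in> vector_fields A" "Y \<in> vector_fields A"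
  shows "(\<lambda>p. X p + Y p) \<in> vector_fields A"
  using assms smooth_fun_add[OF assms(1)]
  by (auto simp: vector_fields_def tangent_space_add field_apply_def plus_tvec.rep_eq)

lemma vector_fields_scale:
  assumes "smooth_manifold A" "X \<in> vector_fields A" "smooth_fun A h"
  shows "(\<lambda>p. h p *\<^sub>R X p) \<in> vector_fields A"
  using assms smooth_fun_mult[OF assms(1)]
  by (auto simp: vector_fields_def tangent_space_scaleR field_apply_def scaleR_tvec.rep_eq)

lemma vector_fields_diff:
  assumes "smooth_manifold A" "X \<in> vector_fields A" "Y \<in> vector_fields A"
  shows "(\<lambda>p. X p - Y p) \<in> vector_fields A"
  using vector_fields_add[OF assms(1,2) vector_fields_scale[OF assms(1,3) smooth_fun_const], of "-1"]
  by simp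

text \<open>With \<open>\<xi>\<close> a cutoff and \<open>G\<close> the functions of Hadamard's lemma, \<open>\<xi>\<^sup>2 (h - h p)\<close> is the sum of the
  products of \<open>\<xi> (\<kappa>\<^sub>b - \<kappa>\<^sub>b p)\<close> and \<open>\<xi> G\<^sub>b\<close>, to which the derivation applies by the product rule.\<close>

lemma tangent_vector_in_chart:
  fixes A :: "('a::{t2_space, second_countable_topology}, 'e::euclidean_space) atlas"
  assumes A: "smooth_manifold A" and c: "(U, \<phi>) \<in> A" and W: "open W" "p \<in> W" "W \<subseteq> U"
    and \<kappa>: "\<And>b. b \<in> Basis \<Longrightarrow> smooth_fun A (\<kappa> b)" "\<And>b x. b \<in> Basis \<Longrightarrow> x \<in> W \<Longrightarrow> \<kappa> b x = \<phi> x \<bullet> b"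
    and v: "v \<in> tangent_space A p" and h: "smooth_fun A h"
  shows "tapply v h = (\<Sum>b\<in>Basis. frechet_derivative (h \<circ> inv_into U \<phi>) (at (\<phi> p)) b * tapply v (\<kappa> b))"
proof -
  note ch = chartD[OF A c]
  let ?F = "h \<circ> inv_into U \<phi>"
  have inv: "inv_into U \<phi> (\<phi> x) = x" if "x \<in> U" for x
    using that ch(3) by (simp add: inv_into_f_f)
  obtain r where r: "r > 0" "ball (\<phi> p) r \<subseteq> \<phi> ` W"
    using W chart_open_image[OF A c W(1,3)] open_contains_ball by blast
  have sF: "smooth_on (ball (\<phi> p) r) ?F"
    by (rule smooth_on_mono[OF smooth_funD[OF h c]]) (use r W in blast)
  obtain G where G: "\<And>b. smooth_on (ball (\<phi> p) r) (G b)"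
    "\<And>b. G b (\<phi> p) = frechet_derivative ?F (at (\<phi> p)) b"
    "\<And>x. x \<in> ball (\<phi> p) r \<Longrightarrow> ?F x = ?F (\<phi> p) + (\<Sum>b\<in>Basis. ((x - \<phi> p) \<bullet> b) * G b x)"
    by (rule Hadamard[OF sF]) (rule that)
  define N where "N = \<phi> -` ball (\<phi> p) r \<inter> U"
  have N: "open N" "p \<in> N" "N \<subseteq> U"
    using continuous_on_open_vimage[OF ch(1)] ch(4) open_ball r W unfolding N_def by auto
  have NW: "N \<subseteq> W"
  proof
    fix x assume "x \<in> N"
    then have "x \<in> U" "\<phi> x \<in> \<phi> ` W" using r by (auto simp: N_def)
    then show "x \<in> W" using inj_on_image_mem_iff[OF ch(3)] W(3) by blast
  qed
  obtain \<xi> W' where \<xi>: "p \<in> W'" "\<And>x. x \<in> W' \<Longrightarrow> \<xi> x = (1::real)" "\<And>x. x \<notin> N \<Longrightarrow> \<xi> x = 0"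
    "\<And>h. smooth_on (\<phi> ` N) (h \<circ> inv_into U \<phi>) \<Longrightarrow> smooth_fun A (\<lambda>x. \<xi> x * h x)"
    using cutoff[OF A c N] by metis
  note oN = chart_open_image[OF A c N(1,3)]
  have sG: "smooth_fun A (\<lambda>x. \<xi> x * G b (\<phi> x))" for b
  proof (rule \<xi>(4))
    have "smooth_on (\<phi> ` N) (G b)" by (rule smooth_on_mono[OF G(1)]) (auto simp: N_def)
    then show "smooth_on (\<phi> ` N) ((\<lambda>x. G b (\<phi> x)) \<circ> inv_into U \<phi>)"
      by (rule smooth_on_cong[OF oN, THEN iffD1, rotated]) (use N inv in auto)
  qed
  have s\<xi>: "smooth_fun A \<xi>" using \<xi>(4)[of "\<lambda>x. 1"] by (simp add: o_def smooth_on_const)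
  \<comment> \<open>\<mu>\<open>b\<close> vanishes at \<open>p\<close> and has the same value under
    \<open>v\<close> as \<kappa>\<open>b\<close>. Hence the product rule applied to
    \<mu>\<open>b\<close> times the cut-off \<open>G b\<close> leaves a single term.\<close>
  define \<mu> where "\<mu> b x = \<xi> x * (\<kappa> b x - \<kappa> b p)" for b x
  have s\<mu>: "smooth_fun A (\<mu> b)" if "b \<in> Basis" for b unfolding \<mu>_def
    by (intro smooth_fun_mult smooth_fun_diff smooth_fun_const A s\<xi> \<kappa> that)
  \<comment> \<open>At \<open>p\<close> the cutoff is 1 and \<open>k - k p\<close> is 0, so the term
    in which \<xi> is differentiated drops out. A derivation is thus insensitive to such
    cutoffs.\<close>
  have v\<xi>: "tapply v (\<lambda>x. \<xi> x * (k x - k p)) = tapply v k" if "smooth_fun A k" for k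
    using tangent_spaceD(4)[OF v s\<xi> smooth_fun_diff[OF A that smooth_fun_const], of "k p"]
      tangent_vector_diff[OF A v that smooth_fun_const, of "k p"] \<xi>(1,2)
    by (simp add: tangent_vector_const[OF v])
  have "(\<lambda>x. \<xi> x * (\<xi> x * (h x - h p))) = (\<lambda>x. \<Sum>b\<in>Basis. \<mu> b x * (\<xi> x * G b (\<phi> x)))"
  proof
    fix x
    show "\<xi> x * (\<xi> x * (h x - h p)) = (\<Sum>b\<in>Basis. \<mu> b x * (\<xi> x * G b (\<phi> x)))"
    proof (cases "x \<in> N")
      case True
      then have "h x - h p = (\<Sum>b\<in>Basis. ((\<phi> x - \<phi> p) \<bullet> b) * G b (\<phi> x))"
        using G(3)[of "\<phi> x"] N inv by (auto simp: N_def)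
      also have "\<dots> = (\<Sum>b\<in>Basis. (\<kappa> b x - \<kappa> b p) * G b (\<phi> x))"
        by (rule sum.cong) (use True NW W \<kappa>(2) in \<open>auto simp: inner_diff_left subset_iff\<close>)
      finally show ?thesis by (simp add: \<mu>_def sum_distrib_left algebra_simps)
    qed (simp add: \<xi>(3) \<mu>_def)
  qed
  moreover have "tapply v (\<lambda>x. \<xi> x * (\<xi> x * (h x - h p))) = tapply v h"
  proof -
    \<comment> \<open>This function vanishes at \<open>p\<close> too, so the removal of a cutoff can
      be applied twice, once for each factor \<xi>.\<close>
    have "smooth_fun A (\<lambda>x. \<xi> x * (h x - h p))"
      by (intro smooth_fun_mult smooth_fun_diff smooth_fun_const A s\<xi> h)
    from v\<xi>[OF this] v\<xi>[OF h] show ?thesis by simp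
  qed
  ultimately have "tapply v h = (\<Sum>b\<in>Basis. tapply v (\<lambda>x. \<mu> b x * (\<xi> x * G b (\<phi> x))))"
    using tangent_vector_sum[OF A v, of Basis "\<lambda>b x. \<mu> b x * (\<xi> x * G b (\<phi> x))"]
      smooth_fun_mult[OF A s\<mu> sG] by simp
  also have "\<dots> = (\<Sum>b\<in>Basis. G b (\<phi> p) * tapply v (\<kappa> b))"
  proof (rule sum.cong)
    fix b :: 'e assume b: "b \<in> Basis"
    show "tapply v (\<lambda>x. \<mu> b x * (\<xi> x * G b (\<phi> x))) = G b (\<phi> p) * tapply v (\<kappa> b)"
    proof -
      have "tapply v (\<mu> b) = tapply v (\<kappa> b)"
        using v\<xi>[OF \<kappa>(1)[OF b]] by (simp add: \<mu>_def[abs_def])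
      moreover have "\<mu> b p = 0" by (simp add: \<mu>_def)
      ultimately show ?thesis
        using tangent_spaceD(4)[OF v s\<mu>[OF b] sG] \<xi>(1,2) by simp
    qed
  qed simp
  finally show ?thesis by (simp add: G(2))
qed

text \<open>The chart derivative along the fixed vector \<open>w\<close>, times a cutoff that makes
  it vanish outside \<open>U\<close>, where the chart expression has no meaning. Near
  \<open>p\<close> the cutoff is 1, so the value at \<open>p\<close> is the unmodified
  derivative.\<close>

lemma directional_field:
  fixes A :: "('a::{t2_space, second_countable_topology}, 'e::euclidean_space) atlas"
  assumes A: "smooth_manifold A" and c: "(U, \<phi>) \<in> A" "p \<in> U"
  obtains X where "X \<in> vector_fields A"
    "\<And>h. smooth_fun A h \<Longrightarrow> tapply (X p) h = frechet_derivative (h \<circ> inv_into U \<phi>) (at (\<phi> p)) w"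
proof -
  note ch = chartD[OF A c(1)]
  have inv: "inv_into U \<phi> (\<phi> x) = x" if "x \<in> U" for x
    using that ch(3) by (simp add: inv_into_f_f)
  obtain \<xi> W where \<xi>: "p \<in> W" "\<And>x. x \<in> W \<Longrightarrow> \<xi> x = 1" "\<And>x. x \<notin> U \<Longrightarrow> \<xi> x = 0"
    "\<And>h. smooth_on (\<phi> ` U) (h \<circ> inv_into U \<phi>) \<Longrightarrow> smooth_fun A (\<lambda>x. \<xi> x * h x)"
    using cutoff[OF A c(1) ch(1) c(2) order_refl] by metis
  define d where "d h x = frechet_derivative ((h :: 'a \<Rightarrow> real) \<circ> inv_into U \<phi>) (at (\<phi> x)) w" for h x
  define X where "X x = Tvec (\<lambda>h. if smooth_fun A h then \<xi> x * d h x else 0)" for x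
  have X: "tapply (X x) h = (if smooth_fun A h then \<xi> x * d h x else 0)" for x h
    by (simp add: X_def Tvec_inverse)
  have der: "((h \<circ> inv_into U \<phi>) has_derivative frechet_derivative (h \<circ> inv_into U \<phi>) (at (\<phi> x))) (at (\<phi> x))"
    if "smooth_fun A h" "x \<in> U" for h x
    by (rule smooth_on_has_derivative[OF smooth_funD[OF that(1) c(1)]]) (use that in auto)
  have "X x \<in> tangent_space A x" for x
  proof (cases "x \<in> U")
    case False
    then show ?thesis using \<xi>(3) by (simp add: tangent_space_def X)
  next
    case True
    have 1: "d (\<lambda>x. h x + k x) x = d h x + d k x" if "smooth_fun A h" "smooth_fun A k" for h k
      using frechet_derivative_at[OF has_derivative_add[OF der[OF that(1) True] der[OF that(2) True]]]
      by (simp add: d_def o_def fun_eq_iff)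
    have 2: "d (\<lambda>x. a * h x) x = a * d h x" if "smooth_fun A h" for h a
      using frechet_derivative_at[OF has_derivative_mult_right[OF der[OF that True]]]
      by (simp add: d_def o_def fun_eq_iff)
    have 3: "d (\<lambda>x. h x * k x) x = h x * d k x + k x * d h x" if "smooth_fun A h" "smooth_fun A k" for h k
      using frechet_derivative_at[OF has_derivative_mult[OF der[OF that(1) True] der[OF that(2) True]]] inv[OF True]
      by (simp add: d_def o_def fun_eq_iff) (metis mult.commute)
    show ?thesis
      using smooth_fun_add[OF A] smooth_fun_mult[OF A] smooth_fun_mult[OF A smooth_fun_const]
      by (auto simp: tangent_space_def X 1 2 3 algebra_simps)
  qed
  moreover have "smooth_fun A (field_apply X h)" if "smooth_fun A h" for h
  proof -
    have "smooth_fun A (\<lambda>x. \<xi> x * d h x)"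
    proof (rule \<xi>(4))
      show "smooth_on (\<phi> ` U) (d h \<circ> inv_into U \<phi>)"
        using smooth_on_frechet_derivative[OF smooth_funD[OF that c(1)], of w]
        by (rule smooth_on_cong[OF ch(2), THEN iffD1, rotated]) (auto simp: d_def inv)
    qed
    then show ?thesis by (simp add: field_apply_def X that)
  qed
  ultimately have "X \<in> vector_fields A" by (simp add: vector_fields_def)
  then show thesis using that[of X] \<xi>(1,2) by (simp add: X d_def)
qed

text \<open>By \<open>tangent_vector_in_chart\<close> a derivation is determined by its values on
  the coordinates. Taking these values as components of \<open>w\<close> gives a directional field
  through \<open>v\<close>. This lets statements about fields be used for arbitrary tangent
  vectors.\<close>

lemma tangent_vector_extends:
  fixes A :: "('a::{t2_space, second_countable_topology}, 'e::euclidean_space) atlas"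
  assumes A: "smooth_manifold A" and v: "v \<in> tangent_space A p"
  obtains X where "X \<in> vector_fields A" "X p = v"
proof -
  obtain U \<phi> where c: "(U, \<phi>) \<in> A" "p \<in> U" using chart_cover[OF A] by metis
  obtain W \<kappa> where W: "open W" "p \<in> W" "W \<subseteq> U" "\<And>b. smooth_fun A (\<kappa> b)"
    "\<And>b x. x \<in> W \<Longrightarrow> \<kappa> b x = \<phi> x \<bullet> b" using chart_coordinates[OF A c] by metis
  define w where "w = (\<Sum>b\<in>Basis. tapply v (\<kappa> b) *\<^sub>R b)"
  obtain X where X: "X \<in> vector_fields A"
    "\<And>h. smooth_fun A h \<Longrightarrow> tapply (X p) h = frechet_derivative (h \<circ> inv_into U \<phi>) (at (\<phi> p)) w"
    using directional_field[OF A c] by metis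
  have "X p = v"
  proof (rule tangent_vector_eqI[OF vector_field_tangent[OF X(1)] v])
    fix h assume h: "smooth_fun A h"
    interpret linear "frechet_derivative (h \<circ> inv_into U \<phi>) (at (\<phi> p))"
      by (rule has_derivative_linear[OF smooth_on_has_derivative[OF smooth_funD[OF h c(1)]]]) (use c in auto)
    show "tapply (X p) h = tapply v h"
      using tangent_vector_in_chart[OF A c(1) W(1-3) W(4,5) v h]
      by (simp add: X(2)[OF h] w_def sum scale mult.commute)
  qed
  then show thesis using that X by blast
qed

text \<open>The directional field along a basis vector \<open>b\<close> takes the value
  \<open>b \<bullet> b = 1\<close> on the coordinate belonging to \<open>b\<close>.\<close>

lemma exists_nonzero_tangent_vector:
  fixes A :: "('a::{t2_space, second_countable_topology}, 'e::euclidean_space) atlas"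
  assumes A: "smooth_manifold A"
  obtains v where "v \<in> tangent_space A p" "v \<noteq> 0"
proof -
  obtain U \<phi> where c: "(U, \<phi>) \<in> A" "p \<in> U" using chart_cover[OF A] by metis
  note ch = chartD[OF A c(1)]
  obtain W \<kappa> where W: "open W" "p \<in> W" "W \<subseteq> U" "\<And>b. smooth_fun A (\<kappa> b)"
    "\<And>b x. x \<in> W \<Longrightarrow> \<kappa> b x = \<phi> x \<bullet> b" using chart_coordinates[OF A c] by metis
  obtain b :: 'e where b: "b \<in> Basis" using nonempty_Basis by blast
  obtain X where X: "X \<in> vector_fields A"
    "\<And>h. smooth_fun A h \<Longrightarrow> tapply (X p) h = frechet_derivative (h \<circ> inv_into U \<phi>) (at (\<phi> p)) b"
    using directional_field[OF A c] by metis
  have "((\<lambda>y. y \<bullet> b) has_derivative (\<lambda>y. y \<bullet> b)) (at (\<phi> p))"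
    by (rule bounded_linear_imp_has_derivative[OF bounded_linear_inner_left])
  then have "frechet_derivative (\<lambda>y. y \<bullet> b) (at (\<phi> p)) = (\<lambda>y. y \<bullet> b)"
    using frechet_derivative_at by metis
  moreover have "frechet_derivative (\<kappa> b \<circ> inv_into U \<phi>) (at (\<phi> p)) = frechet_derivative (\<lambda>y. y \<bullet> b) (at (\<phi> p))"
    by (rule frechet_derivative_cong_open[OF chart_open_image[OF A c(1) W(1,3)]])
      (use W ch(3) in \<open>auto simp: inv_into_f_f subset_iff\<close>)
  ultimately have "tapply (X p) (\<kappa> b) = 1" using X(2)[OF W(4)] b by simp
  then have "X p \<noteq> 0" by (auto simp: zero_tvec.rep_eq)
  then show thesis using that vector_field_tangent[OF X(1)] by blast
qed

section \<open>Product manifolds\<close>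

lemma prod_chart:
  "(U, \<phi>) \<in> A1 \<Longrightarrow> (V, \<psi>) \<in> A2 \<Longrightarrow> (U \<times> V, map_prod \<phi> \<psi>) \<in> prod_atlas A1 A2"
  by (auto simp: prod_atlas_def)

lemma image_map_prod: "map_prod \<phi> \<psi> ` (U \<times> V) = \<phi> ` U \<times> \<psi> ` V"
  by (rule map_prod_surj_on) auto

lemma inv_into_map_prod:
  assumes "inj_on \<phi> U" "inj_on \<psi> V" "z \<in> \<phi> ` U \<times> \<psi> ` V"
  shows "inv_into (U \<times> V) (map_prod \<phi> \<psi>) z = (inv_into U \<phi> (fst z), inv_into V \<psi> (snd z))"
  by (rule inv_into_f_eq[OF map_prod_inj_on[OF assms(1,2)]])
    (use assms(3) in \<open>auto simp: inv_into_into f_inv_into_f\<close>)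

lemma smooth_manifold_prod:
  fixes A1 :: "('a::{t2_space, second_countable_topology}, 'e::euclidean_space) atlas"
    and A2 :: "('b::{t2_space, second_countable_topology}, 'f::euclidean_space) atlas"
  assumes A1: "smooth_manifold A1" and A2: "smooth_manifold A2"
  shows "smooth_manifold (prod_atlas A1 A2)"
  unfolding smooth_manifold_def
proof (intro conjI ballI)
  fix c assume "c \<in> prod_atlas A1 A2"
  then obtain U \<phi> V \<psi> where c: "c = (U \<times> V, map_prod \<phi> \<psi>)" "(U, \<phi>) \<in> A1" "(V, \<psi>) \<in> A2"
    by (auto simp: prod_atlas_def)
  note a = chartD[OF A1 c(2)] and b = chartD[OF A2 c(3)]
  have inj: "inj_on (map_prod \<phi> \<psi>) (U \<times> V)" by (rule map_prod_inj_on[OF a(3) b(3)])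
  have "continuous_on (U \<times> V) (\<lambda>z. (\<phi> (fst z), \<psi> (snd z)))"
    by (intro continuous_on_Pair continuous_on_compose2[OF a(4)] continuous_on_compose2[OF b(4)]
        continuous_on_fst continuous_on_snd continuous_on_id) auto
  then have 1: "continuous_on (U \<times> V) (map_prod \<phi> \<psi>)" by (simp add: map_prod_def split_beta)
  have "continuous_on (\<phi> ` U \<times> \<psi> ` V) (\<lambda>z. (inv_into U \<phi> (fst z), inv_into V \<psi> (snd z)))"
    by (intro continuous_on_Pair continuous_on_compose2[OF a(5)] continuous_on_compose2[OF b(5)]
        continuous_on_fst continuous_on_snd continuous_on_id) auto
  then have 2: "continuous_on (\<phi> ` U \<times> \<psi> ` V) (inv_into (U \<times> V) (map_prod \<phi> \<psi>))"
    by (rule continuous_on_cong[OF refl, THEN iffD1, rotated])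
      (simp add: inv_into_map_prod[OF a(3) b(3)])
  have "homeomorphism (U \<times> V) (\<phi> ` U \<times> \<psi> ` V) (map_prod \<phi> \<psi>) (inv_into (U \<times> V) (map_prod \<phi> \<psi>))"
    by (rule homeomorphismI[OF 1 2])
      (use a(3) b(3) inj in \<open>auto simp: inv_into_map_prod inv_into_into\<close>)
  then show "is_chart c"
    using a b inj by (simp add: is_chart_def c image_map_prod open_Times)
next
  have "\<exists>c\<in>prod_atlas A1 A2. (p, q) \<in> fst c" for p q
  proof -
    obtain U \<phi> where "(U, \<phi>) \<in> A1" "p \<in> U" using chart_cover[OF A1] by metis
    moreover obtain V \<psi> where "(V, \<psi>) \<in> A2" "q \<in> V" using chart_cover[OF A2] by metis
    ultimately show ?thesis using prod_chart[of U \<phi> A1 V \<psi> A2] by force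
  qed
  then show "(\<Union>(U, \<phi>)\<in>prod_atlas A1 A2. U) = UNIV" by (auto simp: split_beta)
next
  have tr: "smooth_on (map_prod \<phi> \<psi> ` (U \<times> V \<inter> U' \<times> V')) (map_prod \<phi>' \<psi>' \<circ> inv_into (U \<times> V) (map_prod \<phi> \<psi>))"
    if c: "(U, \<phi>) \<in> A1" "(V, \<psi>) \<in> A2" "(U', \<phi>') \<in> A1" "(V', \<psi>') \<in> A2" for U \<phi> V \<psi> U' \<phi>' V' \<psi>'
  proof -
    note a = chartD[OF A1 c(1)] and b = chartD[OF A2 c(2)]
    note a' = chartD[OF A1 c(3)] and b' = chartD[OF A2 c(4)]
    define S where "S = \<phi> ` (U \<inter> U')"
    define T where "T = \<psi> ` (V \<inter> V')"
    have o: "open S" "open T"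
      unfolding S_def T_def using a(1) b(1) a'(1) b'(1)
      by (auto intro!: chart_open_image[OF A1 c(1)] chart_open_image[OF A2 c(2)])
    then have oST: "open (S \<times> T)" by (rule open_Times)
    have s1: "smooth_on S (\<phi>' \<circ> inv_into U \<phi>)" and s2: "smooth_on T (\<psi>' \<circ> inv_into V \<psi>)"
      using A1 A2 c unfolding smooth_manifold_def S_def T_def by blast+
    have "smooth_on (S \<times> T) (\<lambda>z. ((\<phi>' \<circ> inv_into U \<phi>) (fst z), (\<psi>' \<circ> inv_into V \<psi>) (snd z)))"
      by (intro smooth_on_Pair[OF oST] smooth_on_compose[OF oST o(1) _ _ s1]
          smooth_on_compose[OF oST o(2) _ _ s2] smooth_on_linear[OF oST]
          bounded_linear_fst bounded_linear_snd) auto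
    then have "smooth_on (S \<times> T) (map_prod \<phi>' \<psi>' \<circ> inv_into (U \<times> V) (map_prod \<phi> \<psi>))"
    proof (rule smooth_on_cong[OF oST, THEN iffD1, rotated])
      fix z assume "z \<in> S \<times> T"
      then have "z \<in> \<phi> ` U \<times> \<psi> ` V" by (auto simp: S_def T_def)
      then show "((\<phi>' \<circ> inv_into U \<phi>) (fst z), (\<psi>' \<circ> inv_into V \<psi>) (snd z)) =
        (map_prod \<phi>' \<psi>' \<circ> inv_into (U \<times> V) (map_prod \<phi> \<psi>)) z"
        by (simp add: inv_into_map_prod[OF a(3) b(3)])
    qed
    then show ?thesis by (simp add: Times_Int_Times image_map_prod S_def T_def)
  qed
  fix c assume "c \<in> prod_atlas A1 A2"
  then show "case c of (U, \<phi>) \<Rightarrow> \<forall>(V, \<psi>)\<in>prod_atlas A1 A2.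
      smooth_on (\<phi> ` (U \<inter> V)) (\<psi> \<circ> inv_into U \<phi>)"
    using tr by (auto simp: prod_atlas_def)
qed

lemma smooth_fun_prodI:
  assumes A1: "smooth_manifold A1" and A2: "smooth_manifold A2"
    and h: "\<And>U \<phi> V \<psi>. (U, \<phi>) \<in> A1 \<Longrightarrow> (V, \<psi>) \<in> A2 \<Longrightarrow>
      smooth_on (\<phi> ` U \<times> \<psi> ` V) (\<lambda>z. h (inv_into U \<phi> (fst z), inv_into V \<psi> (snd z)))"
  shows "smooth_fun (prod_atlas A1 A2) h"
proof -
  have "smooth_on (map_prod \<phi> \<psi> ` (U \<times> V)) (h \<circ> inv_into (U \<times> V) (map_prod \<phi> \<psi>))"
    if c: "(U, \<phi>) \<in> A1" "(V, \<psi>) \<in> A2" for U \<phi> V \<psi>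
    unfolding image_map_prod using h[OF c]
    by (rule smooth_on_cong[OF open_Times[OF chartD(2)[OF A1 c(1)] chartD(2)[OF A2 c(2)]], THEN iffD1, rotated])
      (simp add: inv_into_map_prod[OF chartD(3)[OF A1 c(1)] chartD(3)[OF A2 c(2)]])
  then show ?thesis unfolding smooth_fun_def prod_atlas_def by blast
qed

lemma smooth_fun_prodD:
  assumes A1: "smooth_manifold A1" and A2: "smooth_manifold A2"
    and h: "smooth_fun (prod_atlas A1 A2) h" and c: "(U, \<phi>) \<in> A1" "(V, \<psi>) \<in> A2"
  shows "smooth_on (\<phi> ` U \<times> \<psi> ` V) (\<lambda>z. h (inv_into U \<phi> (fst z), inv_into V \<psi> (snd z)))"
  using smooth_funD[OF h prod_chart[OF c], unfolded image_map_prod]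
  by (rule smooth_on_cong[OF open_Times[OF chartD(2)[OF A1 c(1)] chartD(2)[OF A2 c(2)]], THEN iffD1, rotated])
    (simp add: inv_into_map_prod[OF chartD(3)[OF A1 c(1)] chartD(3)[OF A2 c(2)]])

lemma smooth_fun_fst:
  fixes A1 :: "('a::{t2_space, second_countable_topology}, 'e::euclidean_space) atlas"
    and A2 :: "('b::{t2_space, second_countable_topology}, 'f::euclidean_space) atlas"
  assumes A1: "smooth_manifold A1" and A2: "smooth_manifold A2" and k: "smooth_fun A1 k"
  shows "smooth_fun (prod_atlas A1 A2) (\<lambda>z. k (fst z))"
proof (rule smooth_fun_prodI[OF A1 A2])
  fix U and \<phi> :: "'a \<Rightarrow> 'e" and V and \<psi> :: "'b \<Rightarrow> 'f" assume c: "(U, \<phi>) \<in> A1" "(V, \<psi>) \<in> A2"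
  have o: "open (\<phi> ` U \<times> \<psi> ` V)" using chartD(2)[OF A1 c(1)] chartD(2)[OF A2 c(2)] by (rule open_Times)
  show "smooth_on (\<phi> ` U \<times> \<psi> ` V) (\<lambda>z. k (fst (inv_into U \<phi> (fst z), inv_into V \<psi> (snd z))))"
    using smooth_on_compose[OF o chartD(2)[OF A1 c(1)] _ smooth_on_linear[OF o bounded_linear_fst] smooth_funD[OF k c(1)]]
    by (auto simp: o_def)
qed

lemma smooth_fun_snd:
  fixes A1 :: "('a::{t2_space, second_countable_topology}, 'e::euclidean_space) atlas"
    and A2 :: "('b::{t2_space, second_countable_topology}, 'f::euclidean_space) atlas"
  assumes A1: "smooth_manifold A1" and A2: "smooth_manifold A2" and k: "smooth_fun A2 k"
  shows "smooth_fun (prod_atlas A1 A2) (\<lambda>z. k (snd z))"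
proof (rule smooth_fun_prodI[OF A1 A2])
  fix U and \<phi> :: "'a \<Rightarrow> 'e" and V and \<psi> :: "'b \<Rightarrow> 'f" assume c: "(U, \<phi>) \<in> A1" "(V, \<psi>) \<in> A2"
  have o: "open (\<phi> ` U \<times> \<psi> ` V)" using chartD(2)[OF A1 c(1)] chartD(2)[OF A2 c(2)] by (rule open_Times)
  show "smooth_on (\<phi> ` U \<times> \<psi> ` V) (\<lambda>z. k (snd (inv_into U \<phi> (fst z), inv_into V \<psi> (snd z))))"
    using smooth_on_compose[OF o chartD(2)[OF A2 c(2)] _ smooth_on_linear[OF o bounded_linear_snd] smooth_funD[OF k c(2)]]
    by (auto simp: o_def)
qed

lemma smooth_fun_slice1:
  fixes A1 :: "('a::{t2_space, second_countable_topology}, 'e::euclidean_space) atlas"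
    and A2 :: "('b::{t2_space, second_countable_topology}, 'f::euclidean_space) atlas"
  assumes A1: "smooth_manifold A1" and A2: "smooth_manifold A2" and h: "smooth_fun (prod_atlas A1 A2) h"
  shows "smooth_fun A1 (\<lambda>x. h (x, q))"
  unfolding smooth_fun_def
proof clarify
  fix U \<phi> assume c: "(U, \<phi>) \<in> A1"
  obtain V \<psi> where d: "(V, \<psi>) \<in> A2" "q \<in> V" using chart_cover[OF A2] by metis
  note a = chartD[OF A1 c] and b = chartD[OF A2 d(1)]
  have "smooth_on (\<phi> ` U) (\<lambda>x. (x, \<psi> q))"
    by (intro smooth_on_Pair smooth_on_ident smooth_on_const a)
  from smooth_on_compose[OF a(2) open_Times[OF a(2) b(2)] _ this smooth_fun_prodD[OF A1 A2 h c d(1)]]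
  show "smooth_on (\<phi> ` U) ((\<lambda>x. h (x, q)) \<circ> inv_into U \<phi>)"
    using d(2) b(3) by (auto simp: o_def inv_into_f_f)
qed

lemma smooth_fun_slice2:
  fixes A1 :: "('a::{t2_space, second_countable_topology}, 'e::euclidean_space) atlas"
    and A2 :: "('b::{t2_space, second_countable_topology}, 'f::euclidean_space) atlas"
  assumes A1: "smooth_manifold A1" and A2: "smooth_manifold A2" and h: "smooth_fun (prod_atlas A1 A2) h"
  shows "smooth_fun A2 (\<lambda>y. h (p, y))"
  unfolding smooth_fun_def
proof clarify
  fix V \<psi> assume d: "(V, \<psi>) \<in> A2"
  obtain U \<phi> where c: "(U, \<phi>) \<in> A1" "p \<in> U" using chart_cover[OF A1] by metis
  note a = chartD[OF A1 c(1)] and b = chartD[OF A2 d]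
  have "smooth_on (\<psi> ` V) (\<lambda>y. (\<phi> p, y))"
    by (intro smooth_on_Pair smooth_on_ident smooth_on_const b)
  from smooth_on_compose[OF b(2) open_Times[OF a(2) b(2)] _ this smooth_fun_prodD[OF A1 A2 h c(1) d]]
  show "smooth_on (\<psi> ` V) ((\<lambda>y. h (p, y)) \<circ> inv_into V \<psi>)"
    using c(2) a(3) by (auto simp: o_def inv_into_f_f)
qed

section \<open>Lifts and tangent vectors of the product\<close>

lemma tapply_lift1:
  "tapply (lift1 A1 A2 X (p, q)) h =
    (if smooth_fun (prod_atlas A1 A2) h then tapply (X p) (\<lambda>x. h (x, q)) else 0)"
  by (simp add: lift1_def tangent_map_def Tvec_inverse o_def)

lemma tapply_lift2:
  "tapply (lift2 A1 A2 Y (p, q)) h =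
    (if smooth_fun (prod_atlas A1 A2) h then tapply (Y q) (\<lambda>y. h (p, y)) else 0)"
  by (simp add: lift2_def tangent_map_def Tvec_inverse o_def)

text \<open>Smoothness on every slice would not give joint smoothness. The chart formula does: near
  a point the result is a finite sum of partial derivatives of the chart expression \<open>H\<close>
  along \<open>(e, 0)\<close>, times the components of \<open>X\<close>, and both kinds of factor
  are smooth in both variables together.\<close>

lemma lift1_vector_field:
  fixes A1 :: "('a::{t2_space, second_countable_topology}, 'e::euclidean_space) atlas"
    and A2 :: "('b::{t2_space, second_countable_topology}, 'f::euclidean_space) atlas"
  assumes A1: "smooth_manifold A1" and A2: "smooth_manifold A2" and X: "X \<in> vector_fields A1"
  shows "lift1 A1 A2 X \<in> vector_fields (prod_atlas A1 A2)"
proof -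
  let ?A = "prod_atlas A1 A2"
  note A = smooth_manifold_prod[OF A1 A2] and sl = smooth_fun_slice1[OF A1 A2]
  note Xd = tangent_spaceD[OF vector_field_tangent[OF X]]
  have T: "lift1 A1 A2 X z \<in> tangent_space ?A z" for z
    by (cases z) (auto simp: tangent_space_def tapply_lift1 sl Xd smooth_fun_add[OF A]
        smooth_fun_mult[OF A] smooth_fun_const smooth_fun_mult[OF A smooth_fun_const])
  moreover have "smooth_fun ?A (field_apply (lift1 A1 A2 X) h)" if h: "smooth_fun ?A h" for h
  proof (rule smooth_fun_local[OF A])
    fix z :: "'a \<times> 'b"
    obtain p q where z: "z = (p, q)" by fastforce
    obtain U \<phi> where c: "(U, \<phi>) \<in> A1" "p \<in> U" using chart_cover[OF A1] by metis
    obtain V \<psi> where d: "(V, \<psi>) \<in> A2" "q \<in> V" using chart_cover[OF A2] by metis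
    note a = chartD[OF A1 c(1)] and b = chartD[OF A2 d(1)]
    obtain W \<kappa> where W: "open W" "p \<in> W" "W \<subseteq> U" "\<And>b. smooth_fun A1 (\<kappa> b)"
      "\<And>b x. x \<in> W \<Longrightarrow> \<kappa> b x = \<phi> x \<bullet> b" using chart_coordinates[OF A1 c] by metis
    define H where "H z = h (inv_into U \<phi> (fst z), inv_into V \<psi> (snd z))" for z
    have H: "smooth_on (\<phi> ` U \<times> \<psi> ` V) H"
      unfolding H_def by (rule smooth_fun_prodD[OF A1 A2 h c(1) d(1)])
    have oW: "open (\<phi> ` W)" by (rule chart_open_image[OF A1 c(1) W(1,3)])
    then have o: "open (\<phi> ` W \<times> \<psi> ` V)" using b(2) by (rule open_Times)
    have sub: "\<phi> ` W \<times> \<psi> ` V \<subseteq> \<phi> ` U \<times> \<psi> ` V" using W(3) by auto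
    have "smooth_on (\<phi> ` W \<times> \<psi> ` V) (\<lambda>z. \<Sum>e\<in>Basis. frechet_derivative H (at z) (e, 0) *
        (field_apply X (\<kappa> e) \<circ> inv_into U \<phi>) (fst z))"
    proof (intro smooth_on_sum[OF o] smooth_on_mult[OF o])
      fix e :: 'e
      show "smooth_on (\<phi> ` W \<times> \<psi> ` V) (\<lambda>z. frechet_derivative H (at z) (e, 0))"
        using smooth_on_frechet_derivative[OF H] sub by (rule smooth_on_mono)
      show "smooth_on (\<phi> ` W \<times> \<psi> ` V) (\<lambda>z. (field_apply X (\<kappa> e) \<circ> inv_into U \<phi>) (fst z))"
        by (rule smooth_on_compose[OF o a(2) _ smooth_on_linear[OF o bounded_linear_fst]
              smooth_funD[OF field_apply_smooth[OF X] c(1)]]) (use W in auto)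
    qed
    then have "smooth_on (\<phi> ` W \<times> \<psi> ` V)
      (field_apply (lift1 A1 A2 X) h \<circ> inv_into (U \<times> V) (map_prod \<phi> \<psi>))"
    proof (rule smooth_on_cong[OF o, THEN iffD1, rotated])
      fix z assume "z \<in> \<phi> ` W \<times> \<psi> ` V"
      then obtain x y where xy: "x \<in> W" "y \<in> V" "z = (\<phi> x, \<psi> y)" by auto
      have xU: "x \<in> U" using xy W by auto
      have inv: "inv_into U \<phi> (\<phi> x) = x" "inv_into V \<psi> (\<psi> y) = y"
        using xU xy a(3) b(3) by (auto simp: inv_into_f_f)
      have e: "(\<lambda>x. h (x, y)) \<circ> inv_into U \<phi> = (\<lambda>u. H (u, \<psi> y))"
        by (auto simp: H_def inv)
      have "((\<lambda>u. (u, \<psi> y)) has_derivative (\<lambda>v. (v, 0))) (at (\<phi> x))"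
        by (auto intro!: derivative_eq_intros)
      from has_derivative_compose[OF this smooth_on_has_derivative[OF H]]
      have "((\<lambda>u. H (u, \<psi> y)) has_derivative (\<lambda>v. frechet_derivative H (at (\<phi> x, \<psi> y)) (v, 0))) (at (\<phi> x))"
        using xU xy by auto
      then have fd: "frechet_derivative (\<lambda>u. H (u, \<psi> y)) (at (\<phi> x)) =
          (\<lambda>v. frechet_derivative H (at (\<phi> x, \<psi> y)) (v, 0))"
        by (rule frechet_derivative_at[symmetric])
      have "(field_apply (lift1 A1 A2 X) h \<circ> inv_into (U \<times> V) (map_prod \<phi> \<psi>)) z =
          tapply (X x) (\<lambda>x. h (x, y))"
        using xy xU by (simp add: inv_into_map_prod[OF a(3) b(3)] inv field_apply_def tapply_lift1 h)
      also have "\<dots> = (\<Sum>e\<in>Basis. frechet_derivative H (at z) (e, 0) *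
          (field_apply X (\<kappa> e) \<circ> inv_into U \<phi>) (fst z))"
        using tangent_vector_in_chart[OF A1 c(1) W(1) xy(1) W(3) W(4,5) vector_field_tangent[OF X] sl[OF h]]
        by (simp add: e fd inv xy(3) field_apply_def)
      finally show "(\<Sum>e\<in>Basis. frechet_derivative H (at z) (e, 0) *
          (field_apply X (\<kappa> e) \<circ> inv_into U \<phi>) (fst z)) =
        (field_apply (lift1 A1 A2 X) h \<circ> inv_into (U \<times> V) (map_prod \<phi> \<psi>)) z" by simp
    qed
    then show "\<exists>U \<phi> N. (U, \<phi>) \<in> ?A \<and> open N \<and> z \<in> N \<and> N \<subseteq> U \<and>
      smooth_on (\<phi> ` N) (field_apply (lift1 A1 A2 X) h \<circ> inv_into U \<phi>)"
      using prod_chart[OF c(1) d(1)] W d b(1) z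
      by (intro exI[of _ "U \<times> V"] exI[of _ "map_prod \<phi> \<psi>"] exI[of _ "W \<times> V"])
        (auto simp: image_map_prod open_Times)
  qed
  ultimately show ?thesis by (simp add: vector_fields_def)
qed

text \<open>The argument of \<open>lift1_vector_field\<close> with partial derivatives along
  \<open>(0, e)\<close>.\<close>

lemma lift2_vector_field:
  fixes A1 :: "('a::{t2_space, second_countable_topology}, 'e::euclidean_space) atlas"
    and A2 :: "('b::{t2_space, second_countable_topology}, 'f::euclidean_space) atlas"
  assumes A1: "smooth_manifold A1" and A2: "smooth_manifold A2" and Y: "Y \<in> vector_fields A2"
  shows "lift2 A1 A2 Y \<in> vector_fields (prod_atlas A1 A2)"
proof -
  let ?A = "prod_atlas A1 A2"
  note A = smooth_manifold_prod[OF A1 A2] and sl = smooth_fun_slice2[OF A1 A2]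
  note Yd = tangent_spaceD[OF vector_field_tangent[OF Y]]
  have T: "lift2 A1 A2 Y z \<in> tangent_space ?A z" for z
    by (cases z) (auto simp: tangent_space_def tapply_lift2 sl Yd smooth_fun_add[OF A]
        smooth_fun_mult[OF A] smooth_fun_const smooth_fun_mult[OF A smooth_fun_const])
  moreover have "smooth_fun ?A (field_apply (lift2 A1 A2 Y) h)" if h: "smooth_fun ?A h" for h
  proof (rule smooth_fun_local[OF A])
    fix z :: "'a \<times> 'b"
    obtain p q where z: "z = (p, q)" by fastforce
    obtain U \<phi> where c: "(U, \<phi>) \<in> A1" "p \<in> U" using chart_cover[OF A1] by metis
    obtain V \<psi> where d: "(V, \<psi>) \<in> A2" "q \<in> V" using chart_cover[OF A2] by metis
    note a = chartD[OF A1 c(1)] and b = chartD[OF A2 d(1)]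
    obtain W \<kappa> where W: "open W" "q \<in> W" "W \<subseteq> V" "\<And>b. smooth_fun A2 (\<kappa> b)"
      "\<And>b y. y \<in> W \<Longrightarrow> \<kappa> b y = \<psi> y \<bullet> b" using chart_coordinates[OF A2 d] by metis
    define H where "H z = h (inv_into U \<phi> (fst z), inv_into V \<psi> (snd z))" for z
    have H: "smooth_on (\<phi> ` U \<times> \<psi> ` V) H"
      unfolding H_def by (rule smooth_fun_prodD[OF A1 A2 h c(1) d(1)])
    have oW: "open (\<psi> ` W)" by (rule chart_open_image[OF A2 d(1) W(1,3)])
    with a(2) have o: "open (\<phi> ` U \<times> \<psi> ` W)" by (rule open_Times)
    have sub: "\<phi> ` U \<times> \<psi> ` W \<subseteq> \<phi> ` U \<times> \<psi> ` V" using W(3) by auto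
    have "smooth_on (\<phi> ` U \<times> \<psi> ` W) (\<lambda>z. \<Sum>e\<in>Basis. frechet_derivative H (at z) (0, e) *
        (field_apply Y (\<kappa> e) \<circ> inv_into V \<psi>) (snd z))"
    proof (intro smooth_on_sum[OF o] smooth_on_mult[OF o])
      fix e :: 'f
      show "smooth_on (\<phi> ` U \<times> \<psi> ` W) (\<lambda>z. frechet_derivative H (at z) (0, e))"
        using smooth_on_frechet_derivative[OF H] sub by (rule smooth_on_mono)
      show "smooth_on (\<phi> ` U \<times> \<psi> ` W) (\<lambda>z. (field_apply Y (\<kappa> e) \<circ> inv_into V \<psi>) (snd z))"
        by (rule smooth_on_compose[OF o b(2) _ smooth_on_linear[OF o bounded_linear_snd]
              smooth_funD[OF field_apply_smooth[OF Y] d(1)]]) (use W in auto)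
    qed
    then have "smooth_on (\<phi> ` U \<times> \<psi> ` W)
      (field_apply (lift2 A1 A2 Y) h \<circ> inv_into (U \<times> V) (map_prod \<phi> \<psi>))"
    proof (rule smooth_on_cong[OF o, THEN iffD1, rotated])
      fix z assume "z \<in> \<phi> ` U \<times> \<psi> ` W"
      then obtain x y where xy: "x \<in> U" "y \<in> W" "z = (\<phi> x, \<psi> y)" by auto
      have yV: "y \<in> V" using xy W by auto
      have inv: "inv_into U \<phi> (\<phi> x) = x" "inv_into V \<psi> (\<psi> y) = y"
        using yV xy a(3) b(3) by (auto simp: inv_into_f_f)
      have e: "(\<lambda>y. h (x, y)) \<circ> inv_into V \<psi> = (\<lambda>u. H (\<phi> x, u))"
        by (auto simp: H_def inv)
      have "((\<lambda>u. (\<phi> x, u)) has_derivative (\<lambda>v. (0, v))) (at (\<psi> y))"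
        by (auto intro!: derivative_eq_intros)
      from has_derivative_compose[OF this smooth_on_has_derivative[OF H]]
      have "((\<lambda>u. H (\<phi> x, u)) has_derivative (\<lambda>v. frechet_derivative H (at (\<phi> x, \<psi> y)) (0, v))) (at (\<psi> y))"
        using yV xy by auto
      then have fd: "frechet_derivative (\<lambda>u. H (\<phi> x, u)) (at (\<psi> y)) =
          (\<lambda>v. frechet_derivative H (at (\<phi> x, \<psi> y)) (0, v))"
        by (rule frechet_derivative_at[symmetric])
      have "(field_apply (lift2 A1 A2 Y) h \<circ> inv_into (U \<times> V) (map_prod \<phi> \<psi>)) z =
          tapply (Y y) (\<lambda>y. h (x, y))"
        using xy yV by (simp add: inv_into_map_prod[OF a(3) b(3)] inv field_apply_def tapply_lift2 h)
      also have "\<dots> = (\<Sum>e\<in>Basis. frechet_derivative H (at z) (0, e) *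
          (field_apply Y (\<kappa> e) \<circ> inv_into V \<psi>) (snd z))"
        using tangent_vector_in_chart[OF A2 d(1) W(1) xy(2) W(3) W(4,5) vector_field_tangent[OF Y] sl[OF h]]
        by (simp add: e fd inv xy(3) field_apply_def)
      finally show "(\<Sum>e\<in>Basis. frechet_derivative H (at z) (0, e) *
          (field_apply Y (\<kappa> e) \<circ> inv_into V \<psi>) (snd z)) =
        (field_apply (lift2 A1 A2 Y) h \<circ> inv_into (U \<times> V) (map_prod \<phi> \<psi>)) z" by simp
    qed
    then show "\<exists>U \<phi> N. (U, \<phi>) \<in> ?A \<and> open N \<and> z \<in> N \<and> N \<subseteq> U \<and>
      smooth_on (\<phi> ` N) (field_apply (lift2 A1 A2 Y) h \<circ> inv_into U \<phi>)"
      using prod_chart[OF c(1) d(1)] W c a(1) z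
      by (intro exI[of _ "U \<times> V"] exI[of _ "map_prod \<phi> \<psi>"] exI[of _ "U \<times> W"])
        (auto simp: image_map_prod open_Times)
  qed
  ultimately show ?thesis by (simp add: vector_fields_def)
qed

lemma prod_tangent_vector_zeroI:
  fixes A1 :: "('a::{t2_space, second_countable_topology}, 'e::euclidean_space) atlas"
    and A2 :: "('b::{t2_space, second_countable_topology}, 'f::euclidean_space) atlas"
  assumes A1: "smooth_manifold A1" and A2: "smooth_manifold A2"
    and u: "u \<in> tangent_space (prod_atlas A1 A2) z"
    and u1: "\<And>k. smooth_fun A1 k \<Longrightarrow> tapply u (\<lambda>z. k (fst z)) = 0"
    and u2: "\<And>k. smooth_fun A2 k \<Longrightarrow> tapply u (\<lambda>z. k (snd z)) = 0"
  shows "u = 0"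
proof (rule tangent_vector_eqI[OF u tangent_space_zero])
  note A = smooth_manifold_prod[OF A1 A2]
  obtain p q where z: "z = (p, q)" by fastforce
  obtain U \<phi> where c: "(U, \<phi>) \<in> A1" "p \<in> U" using chart_cover[OF A1] by metis
  obtain V \<psi> where d: "(V, \<psi>) \<in> A2" "q \<in> V" using chart_cover[OF A2] by metis
  obtain W1 \<kappa>1 where W1: "open W1" "p \<in> W1" "W1 \<subseteq> U" "\<And>b. smooth_fun A1 (\<kappa>1 b)"
    "\<And>b x. x \<in> W1 \<Longrightarrow> \<kappa>1 b x = \<phi> x \<bullet> b" using chart_coordinates[OF A1 c] by metis
  obtain W2 \<kappa>2 where W2: "open W2" "q \<in> W2" "W2 \<subseteq> V" "\<And>b. smooth_fun A2 (\<kappa>2 b)"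
    "\<And>b y. y \<in> W2 \<Longrightarrow> \<kappa>2 b y = \<psi> y \<bullet> b" using chart_coordinates[OF A2 d] by metis
  \<comment> \<open>The inner product of a pair is the sum of the inner products of the components,
    so sums of factor coordinates are coordinates of the product. By hypothesis \<open>u\<close>
    kills both summands, and the chart formula then kills every function.\<close>
  define \<kappa> where "\<kappa> b z = \<kappa>1 (fst b) (fst z) + \<kappa>2 (snd b) (snd z)" for b :: "'e \<times> 'f" and z
  note s = smooth_fun_fst[OF A1 A2 W1(4)] smooth_fun_snd[OF A1 A2 W2(4)]
  have \<kappa>: "smooth_fun (prod_atlas A1 A2) (\<kappa> b)" for b
    unfolding \<kappa>_def by (intro smooth_fun_add[OF A] s)
  have "tapply u (\<kappa> b) = 0" for b
    unfolding \<kappa>_def using tangent_spaceD(2)[OF u s] u1[OF W1(4)] u2[OF W2(4)] by simp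
  moreover have "W1 \<times> W2 \<subseteq> U \<times> V" "z \<in> W1 \<times> W2" using W1 W2 z by auto
  moreover have "\<kappa> b x = map_prod \<phi> \<psi> x \<bullet> b" if "x \<in> W1 \<times> W2" for b x
    using that W1(5) W2(5) by (auto simp: \<kappa>_def inner_prod_def)
  ultimately show "tapply u h = tapply 0 h" if "smooth_fun (prod_atlas A1 A2) h" for h
    using tangent_vector_in_chart[OF A prod_chart[OF c(1) d(1)] open_Times[OF W1(1) W2(1)], where \<kappa> = \<kappa>,
        OF _ _ \<kappa> _ u that]
    by (simp add: zero_tvec.rep_eq)
qed

section \<open>Warped products\<close>

text \<open>The algebraic part of \<open>pseudo_riemannian\<close>, split off so that
  \<open>koszul\<close> can be applied to the warped metric as soon as symmetry and bilinearity are
  known.\<close>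

definition bilinear_metric :: "('a, 'e::euclidean_space) atlas \<Rightarrow> 'a metric \<Rightarrow> bool" where
  "bilinear_metric A g \<longleftrightarrow> (\<forall>p. \<forall>u\<in>tangent_space A p. \<forall>v\<in>tangent_space A p.
     g p u v = g p v u \<and>
     (\<forall>c. g p (c *\<^sub>R u) v = c * g p u v) \<and>
     (\<forall>w\<in>tangent_space A p. g p (u + w) v = g p u v + g p w v))"

lemma pseudo_riemannian_bilinear: "pseudo_riemannian A g \<Longrightarrow> bilinear_metric A g"
  by (simp add: pseudo_riemannian_def bilinear_metric_def)

lemma bilinear_metric_sym:
  "bilinear_metric A g \<Longrightarrow> u \<in> tangent_space A p \<Longrightarrow> v \<in> tangent_space A p \<Longrightarrow> g p u v = g p v u"
  unfolding bilinear_metric_def by blast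

lemma bilinear_metric_scale:
  "bilinear_metric A g \<Longrightarrow> u \<in> tangent_space A p \<Longrightarrow> v \<in> tangent_space A p \<Longrightarrow>
    g p (c *\<^sub>R u) v = c * g p u v"
  unfolding bilinear_metric_def by blast

lemma bilinear_metric_add:
  "bilinear_metric A g \<Longrightarrow> u \<in> tangent_space A p \<Longrightarrow> w \<in> tangent_space A p \<Longrightarrow>
    v \<in> tangent_space A p \<Longrightarrow> g p (u + w) v = g p u v + g p w v"
  unfolding bilinear_metric_def by blast

lemma bilinear_metric_diff:
  assumes "bilinear_metric A g" "u \<in> tangent_space A p" "w \<in> tangent_space A p" "v \<in> tangent_space A p"
  shows "g p (u - w) v = g p u v - g p w v"
  using bilinear_metric_add[OF assms(1,2) tangent_space_scaleR[OF assms(3)] assms(4), of "-1"]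
    bilinear_metric_scale[OF assms(1,3,4), of "-1"] by simp

lemma bilinear_metric_zero:
  assumes "bilinear_metric A g" "v \<in> tangent_space A p"
  shows "g p 0 v = 0" "g p v 0 = 0"
  using bilinear_metric_scale[OF assms(1) tangent_space_zero assms(2), of 0]
    bilinear_metric_sym[OF assms(1) tangent_space_zero assms(2)] by simp_all

lemma levi_civitaD:
  assumes "levi_civita A g D" "X \<in> vector_fields A" "Y \<in> vector_fields A"
  shows "D X Y \<in> vector_fields A" "lie_bracket X Y p = D X Y p - D Y X p"
    "Z \<in> vector_fields A \<Longrightarrow>
      field_apply X (\<lambda>q. g q (Y q) (Z q)) p = g p (D X Y p) (Z p) + g p (Y p) (D X Z p)"
    "Z \<in> vector_fields A \<Longrightarrow> D X (\<lambda>p. Y p + Z p) = (\<lambda>p. D X Y p + D X Z p)"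
    "smooth_fun A h \<Longrightarrow> D X (\<lambda>p. h p *\<^sub>R Y p) = (\<lambda>p. field_apply X h p *\<^sub>R Y p + h p *\<^sub>R D X Y p)"
    "smooth_fun A h \<Longrightarrow> D (\<lambda>p. h p *\<^sub>R X p) Y = (\<lambda>p. h p *\<^sub>R D X Y p)"
  using assms unfolding levi_civita_def affine_connection_def by simp_all

text \<open>Vanishing torsion writes the bracket as a difference of two values of the connection,
  which are smooth fields; no computation in charts is involved.\<close>

lemma lie_bracket_vector_field:
  assumes "smooth_manifold A" "levi_civita A g D" "X \<in> vector_fields A" "Y \<in> vector_fields A"
  shows "lie_bracket X Y \<in> vector_fields A"
proof -
  have "lie_bracket X Y = (\<lambda>p. D X Y p - D Y X p)" using levi_civitaD(2)[OF assms(2-4)] by auto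
  then show ?thesis
    using vector_fields_diff[OF assms(1) levi_civitaD(1)[OF assms(2-4)] levi_civitaD(1)[OF assms(2,4,3)]]
    by simp
qed

text \<open>Metric compatibility expands the three derivatives and vanishing torsion the three
  brackets. By symmetry everything cancels except two copies of
  \<open>g p (D X Y p) (Z p)\<close>.\<close>

lemma koszul:
  assumes g: "bilinear_metric A g" and D: "levi_civita A g D"
    and V: "X \<in> vector_fields A" "Y \<in> vector_fields A" "Z \<in> vector_fields A"
  shows "2 * g p (D X Y p) (Z p) =
     field_apply X (\<lambda>q. g q (Y q) (Z q)) p + field_apply Y (\<lambda>q. g q (X q) (Z q)) p
     - field_apply Z (\<lambda>q. g q (X q) (Y q)) p
     + g p (lie_bracket X Y p) (Z p) - g p (lie_bracket X Z p) (Y p) - g p (lie_bracket Y Z p) (X p)"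
proof -
  have T: "W p \<in> tangent_space A p" if "W \<in> vector_fields A" for W
    using that by (rule vector_field_tangent)
  note t = T[OF V(1)] T[OF V(2)] T[OF V(3)]
  have d: "D W W' p \<in> tangent_space A p" if "W \<in> vector_fields A" "W' \<in> vector_fields A" for W W'
    using T levi_civitaD(1)[OF D that] by blast
  show ?thesis
    unfolding levi_civitaD(3)[OF D V(1,2,3)] levi_civitaD(3)[OF D V(2,1,3)] levi_civitaD(3)[OF D V(3,1,2)]
      levi_civitaD(2)[OF D V(1,2)] levi_civitaD(2)[OF D V(1,3)] levi_civitaD(2)[OF D V(2,3)]
    by (simp add: bilinear_metric_diff[OF g] d V t bilinear_metric_sym[OF g t(1) d]
        bilinear_metric_sym[OF g t(2) d])
qed

lemma metric_eqI:
  assumes g: "pseudo_riemannian A g" and u: "u \<in> tangent_space A p" and v: "v \<in> tangent_space A p"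
    and eq: "\<And>Z. Z \<in> vector_fields A \<Longrightarrow> g p u (Z p) = g p v (Z p)"
  shows "u = v"
proof -
  have A: "smooth_manifold A" using g by (simp add: pseudo_riemannian_def)
  have "g p (u - v) w = 0" if w: "w \<in> tangent_space A p" for w
  proof -
    obtain Z where Z: "Z \<in> vector_fields A" "Z p = w" using tangent_vector_extends[OF A w] by metis
    then show ?thesis
      using eq[OF Z(1)] bilinear_metric_diff[OF pseudo_riemannian_bilinear[OF g] u v w] by simp
  qed
  then have "u - v = 0" using g tangent_space_diff[OF u v] unfolding pseudo_riemannian_def by blast
  then show ?thesis by simp
qed

text \<open>In an indefinite metric a nonzero vector may be null, but not all vectors can be: by
  polarization \<open>g\<close> would vanish identically, and nondegeneracy would make the tangent
  space trivial.\<close>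

lemma exists_nonnull_vector:
  assumes g: "pseudo_riemannian A g"
  shows "\<exists>v\<in>tangent_space A p. g p v v \<noteq> 0"
proof (rule ccontr)
  assume "\<not> ?thesis"
  then have null: "g p v v = 0" if "v \<in> tangent_space A p" for v using that by blast
  note b = pseudo_riemannian_bilinear[OF g]
  have "g p u v = 0" if u: "u \<in> tangent_space A p" and v: "v \<in> tangent_space A p" for u v
  proof -
    note s = tangent_space_add[OF u v]
    have "g p (u + v) (u + v) = g p u u + g p v u + (g p u v + g p v v)"
      using bilinear_metric_add[OF b u v s] bilinear_metric_add[OF b u v u] bilinear_metric_add[OF b u v v]
        bilinear_metric_sym[OF b u s] bilinear_metric_sym[OF b v s] by simp
    then show ?thesis using null[OF u] null[OF v] null[OF s] bilinear_metric_sym[OF b u v] by simp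
  qed
  then have "u = 0" if "u \<in> tangent_space A p" for u
    using g that unfolding pseudo_riemannian_def by blast
  moreover obtain u where "u \<in> tangent_space A p" "u \<noteq> 0"
    using exists_nonzero_tangent_vector g unfolding pseudo_riemannian_def by metis
  ultimately show False by blast
qed

lemma tvec_eqI: "(\<And>h. tapply u h = tapply v h) \<Longrightarrow> u = v"
  by (metis tapply_inject ext)

lemma lift1_linear:
  "lift1 A1 A2 (\<lambda>p. X p + Y p) z = lift1 A1 A2 X z + lift1 A1 A2 Y z"
  "lift1 A1 A2 (\<lambda>p. X p - Y p) z = lift1 A1 A2 X z - lift1 A1 A2 Y z"
  by (cases z; rule tvec_eqI; simp add: tapply_lift1 plus_tvec.rep_eq minus_tvec.rep_eq)+

lemma lift2_linear:
  "lift2 A1 A2 (\<lambda>p. X p + Y p) z = lift2 A1 A2 X z + lift2 A1 A2 Y z"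
  "lift2 A1 A2 (\<lambda>p. X p - Y p) z = lift2 A1 A2 X z - lift2 A1 A2 Y z"
  by (cases z; rule tvec_eqI; simp add: tapply_lift2 plus_tvec.rep_eq minus_tvec.rep_eq)+

section \<open>Projections of tangent vectors and lifted fields\<close>

locale product_manifold =
  fixes A1 :: "('a::{t2_space, second_countable_topology}, 'e::euclidean_space) atlas"
    and A2 :: "('b::{t2_space, second_countable_topology}, 'f::euclidean_space) atlas"
  assumes A1: "smooth_manifold A1" and A2: "smooth_manifold A2"
begin

abbreviation A where "A \<equiv> prod_atlas A1 A2"
abbreviation L1 where "L1 \<equiv> lift1 A1 A2"
abbreviation L2 where "L2 \<equiv> lift2 A1 A2"
abbreviation P1 where "P1 \<equiv> tangent_map A A1 fst"
abbreviation P2 where "P2 \<equiv> tangent_map A A2 snd"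

lemmas A = smooth_manifold_prod[OF A1 A2]
lemmas fst_smooth = smooth_fun_fst[OF A1 A2]
lemmas snd_smooth = smooth_fun_snd[OF A1 A2]
lemmas L1_field = lift1_vector_field[OF A1 A2]
lemmas L2_field = lift2_vector_field[OF A1 A2]

lemma tapply_P1: "tapply (P1 u) k = (if smooth_fun A1 k then tapply u (\<lambda>z. k (fst z)) else 0)"
  by (simp add: tangent_map_def Tvec_inverse o_def)

lemma tapply_P2: "tapply (P2 u) k = (if smooth_fun A2 k then tapply u (\<lambda>z. k (snd z)) else 0)"
  by (simp add: tangent_map_def Tvec_inverse o_def)

lemma P1_tangent: "u \<in> tangent_space A z \<Longrightarrow> P1 u \<in> tangent_space A1 (fst z)"
  by (auto simp: tangent_space_def tapply_P1 fst_smooth smooth_fun_add[OF A1] smooth_fun_mult[OF A1]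
      smooth_fun_mult[OF A1 smooth_fun_const])

lemma P2_tangent: "u \<in> tangent_space A z \<Longrightarrow> P2 u \<in> tangent_space A2 (snd z)"
  by (auto simp: tangent_space_def tapply_P2 snd_smooth smooth_fun_add[OF A2] smooth_fun_mult[OF A2]
      smooth_fun_mult[OF A2 smooth_fun_const])

lemma P1_linear: "P1 0 = 0" "P1 (u + v) = P1 u + P1 v" "P1 (u - v) = P1 u - P1 v" "P1 (c *\<^sub>R u) = c *\<^sub>R P1 u"
  by (auto intro!: tvec_eqI simp: tapply_P1 plus_tvec.rep_eq minus_tvec.rep_eq scaleR_tvec.rep_eq zero_tvec.rep_eq)

lemma P2_linear: "P2 0 = 0" "P2 (u + v) = P2 u + P2 v" "P2 (u - v) = P2 u - P2 v" "P2 (c *\<^sub>R u) = c *\<^sub>R P2 u"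
  by (auto intro!: tvec_eqI simp: tapply_P2 plus_tvec.rep_eq minus_tvec.rep_eq scaleR_tvec.rep_eq zero_tvec.rep_eq)

lemma prod_tangent_eqI:
  assumes u: "u \<in> tangent_space A z" and v: "v \<in> tangent_space A z"
    and "P1 u = P1 v" "P2 u = P2 v"
  shows "u = v"
proof -
  have "u - v = 0"
  proof (rule prod_tangent_vector_zeroI[OF A1 A2 tangent_space_diff[OF u v]])
    show "tapply (u - v) (\<lambda>z. k (fst z)) = 0" if "smooth_fun A1 k" for k
      using arg_cong[OF assms(3), of "\<lambda>w. tapply w k"] that by (simp add: tapply_P1 minus_tvec.rep_eq)
    show "tapply (u - v) (\<lambda>z. k (snd z)) = 0" if "smooth_fun A2 k" for k
      using arg_cong[OF assms(4), of "\<lambda>w. tapply w k"] that by (simp add: tapply_P2 minus_tvec.rep_eq)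
  qed
  then show ?thesis by simp
qed

lemma L1_fst:
  assumes "X \<in> vector_fields A1" "smooth_fun A1 k"
  shows "field_apply (L1 X) (\<lambda>z. k (fst z)) = (\<lambda>z. field_apply X k (fst z))"
  using assms by (auto simp: field_apply_def tapply_lift1 fst_smooth)

lemma L1_snd:
  assumes "X \<in> vector_fields A1" "smooth_fun A2 k"
  shows "field_apply (L1 X) (\<lambda>z. k (snd z)) = (\<lambda>z. 0)"
  using assms tangent_vector_const[OF vector_field_tangent[OF assms(1)]]
  by (auto simp: field_apply_def tapply_lift1 snd_smooth)

lemma L2_fst:
  assumes "Y \<in> vector_fields A2" "smooth_fun A1 k"
  shows "field_apply (L2 Y) (\<lambda>z. k (fst z)) = (\<lambda>z. 0)"
  using assms tangent_vector_const[OF vector_field_tangent[OF assms(1)]]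
  by (auto simp: field_apply_def tapply_lift2 fst_smooth)

lemma L2_snd:
  assumes "Y \<in> vector_fields A2" "smooth_fun A2 k"
  shows "field_apply (L2 Y) (\<lambda>z. k (snd z)) = (\<lambda>z. field_apply Y k (snd z))"
  using assms by (auto simp: field_apply_def tapply_lift2 snd_smooth)

lemma P_L1:
  assumes "X \<in> vector_fields A1"
  shows "P1 (L1 X z) = X (fst z)" "P2 (L1 X z) = 0"
proof -
  have "tapply (P1 (L1 X z)) k = tapply (X (fst z)) k" for k
    using L1_fst[OF assms, of k] tangent_spaceD(1)[OF vector_field_tangent[OF assms]]
    by (cases z) (auto simp: tapply_P1 field_apply_def fun_eq_iff)
  then show "P1 (L1 X z) = X (fst z)" by (rule tvec_eqI)
  have "tapply (P2 (L1 X z)) k = tapply 0 k" for k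
    using L1_snd[OF assms, of k] by (cases z) (auto simp: tapply_P2 field_apply_def fun_eq_iff zero_tvec.rep_eq)
  then show "P2 (L1 X z) = 0" by (rule tvec_eqI)
qed

lemma P_L2:
  assumes "Y \<in> vector_fields A2"
  shows "P1 (L2 Y z) = 0" "P2 (L2 Y z) = Y (snd z)"
proof -
  have "tapply (P2 (L2 Y z)) k = tapply (Y (snd z)) k" for k
    using L2_snd[OF assms, of k] tangent_spaceD(1)[OF vector_field_tangent[OF assms]]
    by (cases z) (auto simp: tapply_P2 field_apply_def fun_eq_iff)
  then show "P2 (L2 Y z) = Y (snd z)" by (rule tvec_eqI)
  have "tapply (P1 (L2 Y z)) k = tapply 0 k" for k
    using L2_fst[OF assms, of k] by (cases z) (auto simp: tapply_P1 field_apply_def fun_eq_iff zero_tvec.rep_eq)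
  then show "P1 (L2 Y z) = 0" by (rule tvec_eqI)
qed

lemma lie_bracket_apply:
  "tapply (lie_bracket X Y p) h = tapply (X p) (field_apply Y h) - tapply (Y p) (field_apply X h)"
  by (simp add: lie_bracket_def Tvec_inverse)

text \<open>Used for the gradient: freezing the second coordinate and projecting turns a field of
  the product into one of the first factor.\<close>

lemma push_slice_field:
  assumes "W \<in> vector_fields A"
  shows "(\<lambda>p. P1 (W (p, q))) \<in> vector_fields A1"
  unfolding vector_fields_def
proof (intro CollectI conjI allI impI)
  show "P1 (W (p, q)) \<in> tangent_space A1 p" for p
    using P1_tangent[OF vector_field_tangent[OF assms, of "(p, q)"]] by simp
  show "smooth_fun A1 (field_apply (\<lambda>p. P1 (W (p, q))) k)" if "smooth_fun A1 k" for k
    using smooth_fun_slice1[OF A1 A2 field_apply_smooth[OF assms, of "\<lambda>z. k (fst z)"], of q] that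
    by (simp add: field_apply_def tapply_P1)
qed

end

section \<open>The warped metric and brackets of lifts\<close>

locale warped_product =
  fixes A1 :: "('a::{t2_space, second_countable_topology}, 'e::euclidean_space) atlas"
    and A2 :: "('b::{t2_space, second_countable_topology}, 'f::euclidean_space) atlas"
    and g1 :: "'a metric" and g2 :: "'b metric"
    and D1 :: "'a connection" and D2 :: "'b connection" and D :: "('a \<times> 'b) connection"
    and f :: "'a \<Rightarrow> real"
  assumes g1: "pseudo_riemannian A1 g1" and g2: "pseudo_riemannian A2 g2"
    and f_smooth: "smooth_fun A1 f" and f_pos: "f x > 0"
    and D1: "levi_civita A1 g1 D1" and D2: "levi_civita A2 g2 D2"
    and D: "levi_civita (prod_atlas A1 A2) (warped_metric A1 g1 f A2 g2) D"
begin

sublocale product_manifold A1 A2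
  by unfold_locales (use g1 g2 in \<open>simp_all add: pseudo_riemannian_def\<close>)

abbreviation g where "g \<equiv> warped_metric A1 g1 f A2 g2"

lemmas b1 = pseudo_riemannian_bilinear[OF g1]
lemmas b2 = pseudo_riemannian_bilinear[OF g2]

lemma g_eq: "g z u v = g1 (fst z) (P1 u) (P1 v) + (f (fst z))\<^sup>2 * g2 (snd z) (P2 u) (P2 v)"
  by (simp add: warped_metric_def pullback_metric_def)

lemma b: "bilinear_metric A g"
  unfolding bilinear_metric_def
  by (auto simp: g_eq P1_linear P2_linear algebra_simps
      bilinear_metric_add[OF b1] bilinear_metric_add[OF b2] bilinear_metric_scale[OF b1] bilinear_metric_scale[OF b2]
      bilinear_metric_sym[OF b1 P1_tangent P1_tangent] bilinear_metric_sym[OF b2 P2_tangent P2_tangent]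
      P1_tangent P2_tangent)

text \<open>Test on functions from each factor. On functions of the first coordinate both lifts act
  as the original fields; functions of the second coordinate are killed by both.\<close>

lemma bracket_L1_L1:
  assumes X: "X \<in> vector_fields A1" and Y: "Y \<in> vector_fields A1"
  shows "lie_bracket (L1 X) (L1 Y) = L1 (lie_bracket X Y)"
proof
  fix z
  have B: "lie_bracket X Y \<in> vector_fields A1" by (rule lie_bracket_vector_field[OF A1 D1 X Y])
  have B': "lie_bracket (L1 X) (L1 Y) \<in> vector_fields A"
    by (intro lie_bracket_vector_field[OF A D] L1_field X Y)
  show "lie_bracket (L1 X) (L1 Y) z = L1 (lie_bracket X Y) z"
  proof (rule prod_tangent_eqI[OF vector_field_tangent[OF B'] vector_field_tangent[OF L1_field[OF B]]])
    show "P1 (lie_bracket (L1 X) (L1 Y) z) = P1 (L1 (lie_bracket X Y) z)"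
      unfolding P_L1[OF B]
    proof (rule tvec_eqI)
      fix k
      show "tapply (P1 (lie_bracket (L1 X) (L1 Y) z)) k = tapply (lie_bracket X Y (fst z)) k"
      proof (cases "smooth_fun A1 k")
        case True
        have "tapply (P1 (lie_bracket (L1 X) (L1 Y) z)) k =
          field_apply (L1 X) (\<lambda>z. field_apply Y k (fst z)) z - field_apply (L1 Y) (\<lambda>z. field_apply X k (fst z)) z"
          using True by (simp add: tapply_P1 lie_bracket_apply L1_fst X Y) (simp add: field_apply_def)
        then show ?thesis
          by (simp add: L1_fst X Y field_apply_smooth lie_bracket_apply) (simp add: field_apply_def)
      qed (use tangent_spaceD(1)[OF vector_field_tangent[OF B]] in \<open>simp add: tapply_P1\<close>)
    qed
    show "P2 (lie_bracket (L1 X) (L1 Y) z) = P2 (L1 (lie_bracket X Y) z)"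
      unfolding P_L1[OF B]
      by (rule tvec_eqI) (simp add: X Y
        tangent_vector_const[OF vector_field_tangent[OF L1_field[OF X]]]
        tangent_vector_const[OF vector_field_tangent[OF L1_field[OF Y]]]
        tapply_P2 lie_bracket_apply L1_snd zero_tvec.rep_eq)
  qed
qed

lemma bracket_L2_L2:
  assumes X: "X \<in> vector_fields A2" and Y: "Y \<in> vector_fields A2"
  shows "lie_bracket (L2 X) (L2 Y) = L2 (lie_bracket X Y)"
proof
  fix z
  have B: "lie_bracket X Y \<in> vector_fields A2" by (rule lie_bracket_vector_field[OF A2 D2 X Y])
  have B': "lie_bracket (L2 X) (L2 Y) \<in> vector_fields A"
    by (intro lie_bracket_vector_field[OF A D] L2_field X Y)
  show "lie_bracket (L2 X) (L2 Y) z = L2 (lie_bracket X Y) z"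
  proof (rule prod_tangent_eqI[OF vector_field_tangent[OF B'] vector_field_tangent[OF L2_field[OF B]]])
    show "P2 (lie_bracket (L2 X) (L2 Y) z) = P2 (L2 (lie_bracket X Y) z)"
      unfolding P_L2[OF B]
    proof (rule tvec_eqI)
      fix k
      show "tapply (P2 (lie_bracket (L2 X) (L2 Y) z)) k = tapply (lie_bracket X Y (snd z)) k"
      proof (cases "smooth_fun A2 k")
        case True
        have "tapply (P2 (lie_bracket (L2 X) (L2 Y) z)) k =
          field_apply (L2 X) (\<lambda>z. field_apply Y k (snd z)) z - field_apply (L2 Y) (\<lambda>z. field_apply X k (snd z)) z"
          using True by (simp add: tapply_P2 lie_bracket_apply L2_snd X Y) (simp add: field_apply_def)
        then show ?thesis
          by (simp add: L2_snd X Y field_apply_smooth lie_bracket_apply) (simp add: field_apply_def)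
      qed (use tangent_spaceD(1)[OF vector_field_tangent[OF B]] in \<open>simp add: tapply_P2\<close>)
    qed
    show "P1 (lie_bracket (L2 X) (L2 Y) z) = P1 (L2 (lie_bracket X Y) z)"
      unfolding P_L2[OF B]
      by (rule tvec_eqI) (simp add: X Y
        tangent_vector_const[OF vector_field_tangent[OF L2_field[OF X]]]
        tangent_vector_const[OF vector_field_tangent[OF L2_field[OF Y]]]
        tapply_P1 lie_bracket_apply L2_fst zero_tvec.rep_eq)
  qed
qed

text \<open>On a function from one factor, one of the two fields gives 0, and the other returns a
  function from the same factor, which the first field kills again.\<close>

lemma bracket_L1_L2:
  assumes X: "X \<in> vector_fields A1" and Y: "Y \<in> vector_fields A2"
  shows "lie_bracket (L1 X) (L2 Y) = (\<lambda>z. 0)" "lie_bracket (L2 Y) (L1 X) = (\<lambda>z. 0)"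
proof -
  note X' = L1_field[OF X] and Y' = L2_field[OF Y]
  note c = tangent_vector_const[OF vector_field_tangent[OF X']] tangent_vector_const[OF vector_field_tangent[OF Y']]
  have B: "lie_bracket (L1 X) (L2 Y) \<in> vector_fields A"
    by (rule lie_bracket_vector_field[OF A D X' Y'])
  show 1: "lie_bracket (L1 X) (L2 Y) = (\<lambda>z. 0)"
  proof
    fix z
    show "lie_bracket (L1 X) (L2 Y) z = 0"
    proof (rule prod_tangent_vector_zeroI[OF A1 A2 vector_field_tangent[OF B]])
      show "tapply (lie_bracket (L1 X) (L2 Y) z) (\<lambda>z. k (fst z)) = 0" if k: "smooth_fun A1 k" for k
        using fun_cong[OF L2_fst[OF Y field_apply_smooth[OF X]], of k z]
        by (simp add: lie_bracket_apply L1_fst L2_fst X Y k c) (simp add: field_apply_def)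
      show "tapply (lie_bracket (L1 X) (L2 Y) z) (\<lambda>z. k (snd z)) = 0" if k: "smooth_fun A2 k" for k
        using fun_cong[OF L1_snd[OF X field_apply_smooth[OF Y]], of k z]
        by (simp add: lie_bracket_apply L1_snd L2_snd X Y k c) (simp add: field_apply_def)
    qed
  qed
  show "lie_bracket (L2 Y) (L1 X) = (\<lambda>z. 0)"
    using levi_civitaD(2)[OF D X' Y'] levi_civitaD(2)[OF D Y' X'] 1 by (auto simp: fun_eq_iff)
qed

text \<open>The vector \<open>u\<close> is arbitrary because the lemma is applied to the still
  unknown values of \<open>D\<close>: pairing with lifts reads off one projection at a time.\<close>

lemma g_L1:
  assumes "X \<in> vector_fields A1" "u \<in> tangent_space A z"
  shows "g z u (L1 X z) = g1 (fst z) (P1 u) (X (fst z))"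
  using assms by (simp add: g_eq P_L1 bilinear_metric_zero[OF b2] P2_tangent)

lemma g_L2:
  assumes "Y \<in> vector_fields A2" "u \<in> tangent_space A z"
  shows "g z u (L2 Y z) = (f (fst z))\<^sup>2 * g2 (snd z) (P2 u) (Y (snd z))"
  using assms by (simp add: g_eq P_L2 bilinear_metric_zero[OF b1] P1_tangent)

lemma g_L1_L1:
  "X \<in> vector_fields A1 \<Longrightarrow> Y \<in> vector_fields A1 \<Longrightarrow> g z (L1 X z) (L1 Y z) = g1 (fst z) (X (fst z)) (Y (fst z))"
  by (simp add: g_L1 vector_field_tangent[OF L1_field] P_L1)

lemma g_L2_L2:
  "X \<in> vector_fields A2 \<Longrightarrow> Y \<in> vector_fields A2 \<Longrightarrow>
    g z (L2 X z) (L2 Y z) = (f (fst z))\<^sup>2 * g2 (snd z) (X (snd z)) (Y (snd z))"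
  by (simp add: g_L2 vector_field_tangent[OF L2_field] P_L2)

lemma g_L1_L2:
  assumes "X \<in> vector_fields A1" "Y \<in> vector_fields A2"
  shows "g z (L1 X z) (L2 Y z) = 0" "g z (L2 Y z) (L1 X z) = 0"
  using assms bilinear_metric_zero(1)[OF b2 vector_field_tangent[OF assms(2)]]
    bilinear_metric_zero(1)[OF b1 vector_field_tangent[OF assms(1)]]
  by (simp_all add: g_L1 g_L2 vector_field_tangent[OF L1_field] vector_field_tangent[OF L2_field] P_L1 P_L2)

lemma g1_smooth:
  "X \<in> vector_fields A1 \<Longrightarrow> Y \<in> vector_fields A1 \<Longrightarrow> smooth_fun A1 (\<lambda>p. g1 p (X p) (Y p))"
  using g1 by (simp add: pseudo_riemannian_def)

lemma g2_smooth:
  "X \<in> vector_fields A2 \<Longrightarrow> Y \<in> vector_fields A2 \<Longrightarrow> smooth_fun A2 (\<lambda>p. g2 p (X p) (Y p))"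
  using g2 by (simp add: pseudo_riemannian_def)

lemmas L1_g1 = L1_fst[OF _ g1_smooth]
lemmas L2_g1 = L2_fst[OF _ g1_smooth]
lemmas L1_g2 = L1_snd[OF _ g2_smooth]
lemmas L2_g2 = L2_snd[OF _ g2_smooth]

end

section \<open>The connection on lifted fields\<close>

context warped_product
begin

text \<open>The logarithmic derivative of \<open>f\<close> along \<open>X\<close>.\<close>

abbreviation slope where "slope X p \<equiv> field_apply X f p * inverse (f p)"

lemma slope_smooth: "X \<in> vector_fields A1 \<Longrightarrow> smooth_fun A1 (slope X)"
  using f_pos by (intro smooth_fun_mult smooth_fun_inverse A1 field_apply_smooth f_smooth) (simp_all add: less_le)

text \<open>Against lifts from the first factor the two Koszul formulas agree term by term. Against
  lifts from the second every term vanishes: mixed products and mixed brackets are 0, and the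
  product of \<open>L1 X\<close> and \<open>L1 Y\<close> is constant along the second
  factor.\<close>

lemma D_L1_L1:
  assumes X: "X \<in> vector_fields A1" and Y: "Y \<in> vector_fields A1"
  shows "D (L1 X) (L1 Y) = L1 (D1 X Y)"
proof
  fix z
  note X' = L1_field[OF X] and Y' = L1_field[OF Y] and DXY = levi_civitaD(1)[OF D1 X Y]
  have T: "D (L1 X) (L1 Y) z \<in> tangent_space A z"
    by (rule vector_field_tangent[OF levi_civitaD(1)[OF D X' Y']])
  show "D (L1 X) (L1 Y) z = L1 (D1 X Y) z"
  proof (rule prod_tangent_eqI[OF T vector_field_tangent[OF L1_field[OF DXY]]])
    show "P1 (D (L1 X) (L1 Y) z) = P1 (L1 (D1 X Y) z)"
      unfolding P_L1[OF DXY]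
    proof (rule metric_eqI[OF g1 P1_tangent[OF T] vector_field_tangent[OF DXY]])
      fix Z assume Z: "Z \<in> vector_fields A1"
      show "g1 (fst z) (P1 (D (L1 X) (L1 Y) z)) (Z (fst z)) = g1 (fst z) (D1 X Y (fst z)) (Z (fst z))"
        using koszul[OF b D X' Y' L1_field[OF Z], of z] koszul[OF b1 D1 X Y Z, of "fst z"]
        by (simp add: X Y Z g_L1[OF Z T] g_L1_L1 L1_g1 bracket_L1_L1
            lie_bracket_vector_field[OF A1 D1])
    qed
    show "P2 (D (L1 X) (L1 Y) z) = P2 (L1 (D1 X Y) z)"
      unfolding P_L1[OF DXY]
    proof (rule metric_eqI[OF g2 P2_tangent[OF T] tangent_space_zero])
      fix Z assume Z: "Z \<in> vector_fields A2"
      have "(f (fst z))\<^sup>2 * g2 (snd z) (P2 (D (L1 X) (L1 Y) z)) (Z (snd z)) = 0"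
        using koszul[OF b D X' Y' L2_field[OF Z], of z]
          tangent_vector_const[OF vector_field_tangent[OF X'], of z 0]
          tangent_vector_const[OF vector_field_tangent[OF Y'], of z 0]
          bilinear_metric_zero(1)[OF b vector_field_tangent[OF X'], of z]
          bilinear_metric_zero(1)[OF b vector_field_tangent[OF Y'], of z]
        by (simp add: X Y Z g_L2[OF Z T] g_L1_L1 g_L1_L2 L2_g1 bracket_L1_L1 bracket_L1_L2
            lie_bracket_vector_field[OF A1 D1]) (simp add: field_apply_def)
      then show "g2 (snd z) (P2 (D (L1 X) (L1 Y) z)) (Z (snd z)) = g2 (snd z) 0 (Z (snd z))"
        using f_pos[of "fst z"] bilinear_metric_zero(1)[OF b2 vector_field_tangent[OF Z]] by simp
    qed
  qed
qed

text \<open>Against \<open>L2 Z\<close> only one Koszul term survives, the derivative of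
  \<open>f^2 g2(Y, Z)\<close> along \<open>X\<close>, which is \<open>2 f (X f) g2(Y, Z)\<close>;
  dividing by \<open>2 f^2\<close> gives the slope. Against lifts from the first factor nothing
  survives.\<close>

lemma D_L1_L2:
  assumes X: "X \<in> vector_fields A1" and Y: "Y \<in> vector_fields A2"
  shows "D (L1 X) (L2 Y) = (\<lambda>z. slope X (fst z) *\<^sub>R L2 Y z)"
    and "D (L2 Y) (L1 X) = (\<lambda>z. slope X (fst z) *\<^sub>R L2 Y z)"
proof -
  note X' = L1_field[OF X] and Y' = L2_field[OF Y]
  show 1: "D (L1 X) (L2 Y) = (\<lambda>z. slope X (fst z) *\<^sub>R L2 Y z)"
  proof
    fix z
    have T: "D (L1 X) (L2 Y) z \<in> tangent_space A z"
      by (rule vector_field_tangent[OF levi_civitaD(1)[OF D X' Y']])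
    have c0: "field_apply (L1 W) (\<lambda>z. 0) z = 0" "field_apply (L2 W') (\<lambda>z. 0) z = 0"
      if "W \<in> vector_fields A1" "W' \<in> vector_fields A2" for W W'
      using tangent_vector_const[OF vector_field_tangent[OF L1_field[OF that(1)]]]
        tangent_vector_const[OF vector_field_tangent[OF L2_field[OF that(2)]]]
      by (simp_all add: field_apply_def)
    note z0 = bilinear_metric_zero(1)[OF b vector_field_tangent[OF L1_field]]
      bilinear_metric_zero(1)[OF b vector_field_tangent[OF L2_field]]
    show "D (L1 X) (L2 Y) z = slope X (fst z) *\<^sub>R L2 Y z"
    proof (rule prod_tangent_eqI[OF T tangent_space_scaleR[OF vector_field_tangent[OF Y']]])
      show "P1 (D (L1 X) (L2 Y) z) = P1 (slope X (fst z) *\<^sub>R L2 Y z)"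
        unfolding P1_linear P_L2[OF Y] scaleR_zero_right
      proof (rule metric_eqI[OF g1 P1_tangent[OF T] tangent_space_zero])
        fix Z assume Z: "Z \<in> vector_fields A1"
        have "g1 (fst z) (P1 (D (L1 X) (L2 Y) z)) (Z (fst z)) = 0"
          using koszul[OF b D X' Y' L1_field[OF Z], of z]
          by (simp add: X Y Z g_L1[OF Z T] g_L1_L1 g_L1_L2 L2_g1 bracket_L1_L1 bracket_L1_L2
              lie_bracket_vector_field[OF A1 D1] c0[OF X Y] c0[OF Z Y] z0)
        then show "g1 (fst z) (P1 (D (L1 X) (L2 Y) z)) (Z (fst z)) = g1 (fst z) 0 (Z (fst z))"
          using bilinear_metric_zero(1)[OF b1 vector_field_tangent[OF Z]] by simp
      qed
      show "P2 (D (L1 X) (L2 Y) z) = P2 (slope X (fst z) *\<^sub>R L2 Y z)"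
        unfolding P2_linear P_L2[OF Y]
      proof (rule metric_eqI[OF g2 P2_tangent[OF T] tangent_space_scaleR[OF vector_field_tangent[OF Y]]])
        fix Z assume Z: "Z \<in> vector_fields A2"
        note s = smooth_fun_mult[OF A1 f_smooth f_smooth]
        have "field_apply (L1 X) (\<lambda>z. (f (fst z))\<^sup>2 * g2 (snd z) (Y (snd z)) (Z (snd z))) z =
          2 * f (fst z) * field_apply X f (fst z) * g2 (snd z) (Y (snd z)) (Z (snd z))"
        proof -
          have "field_apply (L1 X) (\<lambda>z. (f (fst z) * f (fst z)) * g2 (snd z) (Y (snd z)) (Z (snd z))) z =
            (f (fst z) * f (fst z)) * field_apply (L1 X) (\<lambda>z. g2 (snd z) (Y (snd z)) (Z (snd z))) z
            + g2 (snd z) (Y (snd z)) (Z (snd z)) * field_apply (L1 X) (\<lambda>z. f (fst z) * f (fst z)) z"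
            using tangent_spaceD(4)[OF vector_field_tangent[OF X'] fst_smooth[OF s] snd_smooth[OF g2_smooth[OF Y Z]], of z]
            by (simp add: field_apply_def)
          also have "field_apply (L1 X) (\<lambda>z. f (fst z) * f (fst z)) z = 2 * f (fst z) * field_apply X f (fst z)"
            using tangent_spaceD(4)[OF vector_field_tangent[OF X] f_smooth f_smooth, of "fst z"]
            unfolding L1_fst[OF X s] by (simp add: field_apply_def)
          finally show ?thesis
            unfolding L1_g2[OF X Y Z] by (simp add: power2_eq_square)
        qed
        then have "2 * ((f (fst z))\<^sup>2 * g2 (snd z) (P2 (D (L1 X) (L2 Y) z)) (Z (snd z))) =
          2 * f (fst z) * field_apply X f (fst z) * g2 (snd z) (Y (snd z)) (Z (snd z))"
          using koszul[OF b D X' Y' L2_field[OF Z], of z]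
          by (simp add: X Y Z g_L2[OF Z T] g_L2_L2 g_L1_L2 bracket_L2_L2 bracket_L1_L2
              lie_bracket_vector_field[OF A2 D2] c0[OF X Y] c0[OF X Z] z0)
        then show "g2 (snd z) (P2 (D (L1 X) (L2 Y) z)) (Z (snd z)) =
            g2 (snd z) (slope X (fst z) *\<^sub>R Y (snd z)) (Z (snd z))"
          using f_pos[of "fst z"]
          by (simp add: bilinear_metric_scale[OF b2 vector_field_tangent[OF Y] vector_field_tangent[OF Z]]
              power2_eq_square field_simps)
      qed
    qed
  qed
  \<comment> \<open>The mixed bracket is 0, so vanishing torsion makes the two orders equal.\<close>
  show "D (L2 Y) (L1 X) = (\<lambda>z. slope X (fst z) *\<^sub>R L2 Y z)"
    using levi_civitaD(2)[OF D X' Y'] bracket_L1_L2[OF X Y] 1 by (simp add: fun_eq_iff)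
qed

text \<open>Existence of the gradient comes for free from the given connection: the component of
  \<open>\<nabla>\<^bsub>Y\<^esub> Y\<close> along the first factor, for a lifted field \<open>Y\<close> that is not null at a point of the second
  factor, is a multiple of \<open>grad f\<close>.\<close>

lemma g1_P1_D_L2_L2:
  assumes Y: "Y \<in> vector_fields A2" and Z: "Z \<in> vector_fields A2" and X: "X \<in> vector_fields A1"
  shows "g1 (fst z) (P1 (D (L2 Y) (L2 Z) z)) (X (fst z)) =
    - (f (fst z) * g2 (snd z) (Y (snd z)) (Z (snd z))) * field_apply X f (fst z)"
proof -
  note X' = L1_field[OF X] and Y' = L2_field[OF Y] and Z' = L2_field[OF Z]
  have T: "D (L2 Y) (L2 Z) z \<in> tangent_space A z"
    by (rule vector_field_tangent[OF levi_civitaD(1)[OF D Y' Z']])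
  \<comment> \<open>Differentiate the identity \<open>g(L2 Z, L1 X) = 0\<close> along
    \<open>L2 Y\<close>; the second term is known from \<open>D_L1_L2\<close>.\<close>
  have "0 = g z (D (L2 Y) (L2 Z) z) (L1 X z) + g z (L2 Z z) (D (L2 Y) (L1 X) z)"
    using levi_civitaD(3)[OF D Y' Z' X', of z] tangent_vector_const[OF vector_field_tangent[OF Y'], of z 0]
    by (simp add: g_L1_L2 X Z) (simp add: field_apply_def)
  moreover have "g z (L2 Z z) (D (L2 Y) (L1 X) z) =
      slope X (fst z) * ((f (fst z))\<^sup>2 * g2 (snd z) (Y (snd z)) (Z (snd z)))"
    unfolding D_L1_L2[OF X Y]
    using bilinear_metric_sym[OF b vector_field_tangent[OF Z'] tangent_space_scaleR[OF vector_field_tangent[OF Y']]]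
      bilinear_metric_scale[OF b vector_field_tangent[OF Y'] vector_field_tangent[OF Z']]
    by (simp add: g_L2_L2 Y Z)
  ultimately show ?thesis
    using f_pos[of "fst z"] by (simp add: g_L1[OF X T] power2_eq_square field_simps)
qed

abbreviation grad where "grad \<equiv> gradient A1 g1 f"

lemma gradient_exists:
  "\<exists>G. G \<in> vector_fields A1 \<and> (\<forall>X\<in>vector_fields A1. \<forall>p. g1 p (G p) (X p) = field_apply X f p)"
proof -
  obtain q v where v: "v \<in> tangent_space A2 q" "g2 q v v \<noteq> 0"
    using exists_nonnull_vector[OF g2] by blast
  obtain Y where Y: "Y \<in> vector_fields A2" "Y q = v" using tangent_vector_extends[OF A2 v(1)] by metis
  note W = levi_civitaD(1)[OF D L2_field[OF Y(1)] L2_field[OF Y(1)]]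
  \<comment> \<open>By \<open>g1_P1_D_L2_L2\<close> the projected field on the slice through
    \<open>q\<close> pairs with \<open>X\<close> to \<open>- f g2(v, v)\<close> times
    \<open>X f\<close>; \<open>c\<close> is the reciprocal of that factor, defined since
    \<open>v\<close> is not null.\<close>
  define c where "c p = (- inverse (g2 q v v)) * inverse (f p)" for p
  define G where "G p = c p *\<^sub>R P1 (D (L2 Y) (L2 Y) (p, q))" for p
  have "smooth_fun A1 c" unfolding c_def using f_pos
    by (intro smooth_fun_mult smooth_fun_const smooth_fun_inverse A1 f_smooth) (simp add: less_le)
  then have "G \<in> vector_fields A1"
    unfolding G_def by (rule vector_fields_scale[OF A1 push_slice_field[OF W]])
  moreover have "g1 p (G p) (X p) = field_apply X f p" if X: "X \<in> vector_fields A1" for X p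
  proof -
    have "g1 p (G p) (X p) = c p * g1 p (P1 (D (L2 Y) (L2 Y) (p, q))) (X p)"
      unfolding G_def
      by (rule bilinear_metric_scale[OF b1 vector_field_tangent[OF push_slice_field[OF W]] vector_field_tangent[OF X]])
    then show ?thesis
      using g1_P1_D_L2_L2[OF Y(1) Y(1) X, of "(p, q)"] v(2) f_pos[of p] Y(2)
      by (simp add: c_def field_simps)
  qed
  ultimately show ?thesis by blast
qed

lemma grad_field: "grad \<in> vector_fields A1"
  and g1_grad: "X \<in> vector_fields A1 \<Longrightarrow> g1 p (grad p) (X p) = field_apply X f p"
proof -
  have "\<exists>!G. G \<in> vector_fields A1 \<and> (\<forall>X\<in>vector_fields A1. \<forall>p. g1 p (G p) (X p) = field_apply X f p)"
  proof (rule ex_ex1I[OF gradient_exists])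
    fix G H
    assume G: "G \<in> vector_fields A1 \<and> (\<forall>X\<in>vector_fields A1. \<forall>p. g1 p (G p) (X p) = field_apply X f p)"
      and H: "H \<in> vector_fields A1 \<and> (\<forall>X\<in>vector_fields A1. \<forall>p. g1 p (H p) (X p) = field_apply X f p)"
    show "G = H"
    proof
      show "G p = H p" for p
        using G H by (metis metric_eqI[OF g1] vector_field_tangent)
    qed
  qed
  from theI'[OF this] show "grad \<in> vector_fields A1"
    "X \<in> vector_fields A1 \<Longrightarrow> g1 p (grad p) (X p) = field_apply X f p"
    unfolding gradient_def by blast+
qed

lemma D_L2_L2:
  assumes Y: "Y \<in> vector_fields A2" and Z: "Z \<in> vector_fields A2"
  shows "D (L2 Y) (L2 Z) = (\<lambda>z. L2 (D2 Y Z) z +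
    (- (f (fst z) * g2 (snd z) (Y (snd z)) (Z (snd z)))) *\<^sub>R L1 grad z)"
proof
  fix z
  note Y' = L2_field[OF Y] and Z' = L2_field[OF Z] and DYZ = levi_civitaD(1)[OF D2 Y Z]
  let ?c = "- (f (fst z) * g2 (snd z) (Y (snd z)) (Z (snd z)))"
  have T: "D (L2 Y) (L2 Z) z \<in> tangent_space A z"
    by (rule vector_field_tangent[OF levi_civitaD(1)[OF D Y' Z']])
  show "D (L2 Y) (L2 Z) z = L2 (D2 Y Z) z + ?c *\<^sub>R L1 grad z"
  proof (rule prod_tangent_eqI[OF T tangent_space_add[OF vector_field_tangent[OF L2_field[OF DYZ]]
          tangent_space_scaleR[OF vector_field_tangent[OF L1_field[OF grad_field]]]]])
    have "P1 (D (L2 Y) (L2 Z) z) = ?c *\<^sub>R grad (fst z)"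
    proof (rule metric_eqI[OF g1 P1_tangent[OF T] tangent_space_scaleR[OF vector_field_tangent[OF grad_field]]])
      fix X assume X: "X \<in> vector_fields A1"
      show "g1 (fst z) (P1 (D (L2 Y) (L2 Z) z)) (X (fst z)) = g1 (fst z) (?c *\<^sub>R grad (fst z)) (X (fst z))"
        unfolding g1_P1_D_L2_L2[OF Y Z X] g1_grad[OF X]
          bilinear_metric_scale[OF b1 vector_field_tangent[OF grad_field] vector_field_tangent[OF X]] ..
    qed
    then show "P1 (D (L2 Y) (L2 Z) z) = P1 (L2 (D2 Y Z) z + ?c *\<^sub>R L1 grad z)"
      by (simp add: P1_linear P_L1[OF grad_field] P_L2[OF DYZ])
    have "P2 (D (L2 Y) (L2 Z) z) = D2 Y Z (snd z)"
    proof (rule metric_eqI[OF g2 P2_tangent[OF T] vector_field_tangent[OF DYZ]])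
      fix V assume V: "V \<in> vector_fields A2"
      \<comment> \<open>Along the second factor \<open>f\<close> is constant, so \<open>f^2\<close>
        comes out of every derivative, and the Koszul formula of the product is \<open>f^2\<close>
        times that of \<open>g2\<close>.\<close>
      have der: "field_apply (L2 U) (\<lambda>z. (f (fst z))\<^sup>2 * g2 (snd z) (S (snd z)) (R (snd z))) z =
        (f (fst z))\<^sup>2 * field_apply U (\<lambda>y. g2 y (S y) (R y)) (snd z)"
        if "U \<in> vector_fields A2" "S \<in> vector_fields A2" "R \<in> vector_fields A2" for U S R
      proof -
        note s = smooth_fun_mult[OF A1 f_smooth f_smooth]
        have "field_apply (L2 U) (\<lambda>z. (f (fst z) * f (fst z)) * g2 (snd z) (S (snd z)) (R (snd z))) z =
            (f (fst z) * f (fst z)) * field_apply (L2 U) (\<lambda>z. g2 (snd z) (S (snd z)) (R (snd z))) z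
            + g2 (snd z) (S (snd z)) (R (snd z)) * field_apply (L2 U) (\<lambda>z. f (fst z) * f (fst z)) z"
          using tangent_spaceD(4)[OF vector_field_tangent[OF L2_field[OF that(1)]] fst_smooth[OF s]
              snd_smooth[OF g2_smooth[OF that(2,3)]], of z]
          by (simp add: field_apply_def)
        then show ?thesis
          unfolding L2_fst[OF that(1) s] L2_g2[OF that]
          by (simp add: power2_eq_square)
      qed
      have "2 * ((f (fst z))\<^sup>2 * g2 (snd z) (P2 (D (L2 Y) (L2 Z) z)) (V (snd z))) =
        (f (fst z))\<^sup>2 * (2 * g2 (snd z) (D2 Y Z (snd z)) (V (snd z)))"
        using koszul[OF b D Y' Z' L2_field[OF V], of z]
        unfolding koszul[OF b2 D2 Y Z V]
        by (simp add: Y Z V g_L2[OF V T] g_L2_L2 bracket_L2_L2 lie_bracket_vector_field[OF A2 D2] der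
            algebra_simps)
      then show "g2 (snd z) (P2 (D (L2 Y) (L2 Z) z)) (V (snd z)) = g2 (snd z) (D2 Y Z (snd z)) (V (snd z))"
        using f_pos[of "fst z"] by simp
    qed
    then show "P2 (D (L2 Y) (L2 Z) z) = P2 (L2 (D2 Y Z) z + ?c *\<^sub>R L1 grad z)"
      by (simp add: P2_linear P_L1[OF grad_field] P_L2[OF DYZ])
  qed
qed

section \<open>The curvature on lifted fields\<close>

lemma D_zero:
  assumes "W \<in> vector_fields A"
  shows "D (\<lambda>z. 0) W = (\<lambda>z. 0)"
  using levi_civitaD(6)[OF D assms assms smooth_fun_const, of 0] by simp

lemma curvature_L1_L1_L1:
  assumes X: "X \<in> vector_fields A1" and Y: "Y \<in> vector_fields A1" and Z: "Z \<in> vector_fields A1"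
  shows "curvature D (L1 X) (L1 Y) (L1 Z) z = L1 (curvature D1 X Y Z) z"
  using lie_bracket_vector_field[OF A1 D1 X Y] levi_civitaD(1)[OF D1] X Y Z
  by (simp add: curvature_def D_L1_L1 bracket_L1_L1 lift1_linear)

text \<open>All terms are multiples of \<open>L2 X\<close>. Differentiating \<open>Z f / f\<close>
  along \<open>Y\<close> produces \<open>- (Y f)(Z f) / f^2\<close>, which cancels the product of
  the two slopes, and what remains is the Hessian over \<open>f\<close>.\<close>

lemma curvature_L2_L1_L1:
  assumes X: "X \<in> vector_fields A2" and Y: "Y \<in> vector_fields A1" and Z: "Z \<in> vector_fields A1"
  shows "curvature D (L2 X) (L1 Y) (L1 Z) z =
    (1 / f (fst z) * hessian A1 g1 D1 f Y Z (fst z)) *\<^sub>R L2 X z"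
proof -
  define p where "p = fst z"
  note T = vector_field_tangent[OF Y, of p]
  have DYZ: "D1 Y Z \<in> vector_fields A1" by (rule levi_civitaD(1)[OF D1 Y Z])
  have if_smooth: "smooth_fun A1 (\<lambda>p. inverse (f p))"
    using f_pos by (intro smooth_fun_inverse[OF A1 f_smooth]) (simp add: less_le)
  have "D (L1 Y) (D (L2 X) (L1 Z)) z =
    field_apply Y (slope Z) p *\<^sub>R L2 X z + slope Z p *\<^sub>R slope Y p *\<^sub>R L2 X z"
    using levi_civitaD(5)[OF D L1_field[OF Y] L2_field[OF X] fst_smooth[OF slope_smooth[OF Z]]]
    by (simp add: D_L1_L2 X Y Z L1_fst[OF Y slope_smooth[OF Z]] p_def)
  moreover have "D (L2 X) (D (L1 Y) (L1 Z)) z = slope (D1 Y Z) p *\<^sub>R L2 X z"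
    by (simp add: D_L1_L1 D_L1_L2 X Y Z DYZ p_def)
  moreover have "D (lie_bracket (L2 X) (L1 Y)) (L1 Z) z = 0"
    by (simp add: bracket_L1_L2 X Y D_zero L1_field Z)
  ultimately have R: "curvature D (L2 X) (L1 Y) (L1 Z) z =
    (field_apply Y (slope Z) p + slope Z p * slope Y p - slope (D1 Y Z) p) *\<^sub>R L2 X z"
    by (simp add: curvature_def scaleR_add_left scaleR_diff_left)
  have e1: "field_apply Y (slope Z) p = field_apply Z f p * field_apply Y (\<lambda>p. inverse (f p)) p
      + inverse (f p) * field_apply Y (field_apply Z f) p"
    using tangent_spaceD(4)[OF T field_apply_smooth[OF Z] if_smooth] by (simp add: field_apply_def)
  have e2: "field_apply Y (\<lambda>p. inverse (f p)) p = - (slope Y p * inverse (f p))"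
  proof -
    have "(\<lambda>p. f p * inverse (f p)) = (\<lambda>p. 1)" using f_pos by (auto simp: less_le)
    then have "f p * field_apply Y (\<lambda>p. inverse (f p)) p + inverse (f p) * field_apply Y f p = 0"
      using tangent_spaceD(4)[OF T f_smooth if_smooth] tangent_vector_const[OF T, of 1]
      by (simp add: field_apply_def)
    then show ?thesis using f_pos[of p] by (simp add: field_simps)
  qed
  \<comment> \<open>Differentiating \<open>g1(grad f, Z) = Z f\<close> along \<open>Y\<close> turns
    the Hessian into \<open>Y (Z f) - (D1 Y Z) f\<close>.\<close>
  have e3: "hessian A1 g1 D1 f Y Z p = field_apply Y (field_apply Z f) p - field_apply (D1 Y Z) f p"
    using levi_civitaD(3)[OF D1 Y grad_field Z, of p] unfolding hessian_def g1_grad[OF Z] g1_grad[OF DYZ]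
    by simp
  have "field_apply Y (slope Z) p + slope Z p * slope Y p - slope (D1 Y Z) p =
    1 / f p * hessian A1 g1 D1 f Y Z p"
    unfolding e1 e2 e3 by (simp add: algebra_simps divide_inverse)
  with R show ?thesis by (simp add: p_def)
qed

lemma warping_coeff_smooth:
  "Y \<in> vector_fields A2 \<Longrightarrow> Z \<in> vector_fields A2 \<Longrightarrow>
    smooth_fun A (\<lambda>z. - (f (fst z) * g2 (snd z) (Y (snd z)) (Z (snd z))))"
  using smooth_fun_mult[OF A smooth_fun_const smooth_fun_mult[OF A fst_smooth[OF f_smooth] snd_smooth[OF g2_smooth]], of Y Z "-1"]
  by simp

lemma field_apply_warping_coeff:
  assumes W: "W \<in> vector_fields A" and Y: "Y \<in> vector_fields A2" and Z: "Z \<in> vector_fields A2"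
  shows "field_apply W (\<lambda>z. - (f (fst z) * g2 (snd z) (Y (snd z)) (Z (snd z)))) z =
    - (f (fst z) * field_apply W (\<lambda>z. g2 (snd z) (Y (snd z)) (Z (snd z))) z
       + g2 (snd z) (Y (snd z)) (Z (snd z)) * field_apply W (\<lambda>z. f (fst z)) z)"
proof -
  note s = fst_smooth[OF f_smooth] snd_smooth[OF g2_smooth[OF Y Z]]
  note T = vector_field_tangent[OF W, of z]
  show ?thesis
    using tangent_spaceD(3)[OF T smooth_fun_mult[OF A s], of "-1"] tangent_spaceD(4)[OF T s]
    by (simp add: field_apply_def)
qed

text \<open>The coefficient \<open>m\<close> of the gradient is linear in \<open>f\<close>, so its
  derivative along \<open>X\<close> is the slope of \<open>X\<close> times \<open>m\<close>. With
  this the multiples of \<open>grad f\<close> cancel, as do those of the lift of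
  \<open>D2 Y Z\<close>; only the derivative of \<open>grad f\<close> itself is left.\<close>

lemma curvature_L1_L2_L2:
  assumes X: "X \<in> vector_fields A1" and Y: "Y \<in> vector_fields A2" and Z: "Z \<in> vector_fields A2"
  shows "curvature D (L1 X) (L2 Y) (L2 Z) z =
    (f (fst z) * g2 (snd z) (Y (snd z)) (Z (snd z))) *\<^sub>R L1 (D1 X grad) z"
proof -
  note X' = L1_field[OF X] and Y' = L2_field[OF Y] and Z' = L2_field[OF Z]
  have DYZ: "D2 Y Z \<in> vector_fields A2" by (rule levi_civitaD(1)[OF D2 Y Z])
  define m where "m z = - (f (fst z) * g2 (snd z) (Y (snd z)) (Z (snd z)))" for z
  have m: "smooth_fun A m" unfolding m_def by (rule warping_coeff_smooth[OF Y Z])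
  have mG: "(\<lambda>z. m z *\<^sub>R L1 grad z) \<in> vector_fields A"
    by (rule vector_fields_scale[OF A L1_field[OF grad_field] m])
  have D22: "D (L2 Y) (L2 Z) = (\<lambda>z. L2 (D2 Y Z) z + m z *\<^sub>R L1 grad z)"
    by (simp add: D_L2_L2 Y Z m_def)
  have "D (L2 Y) (D (L1 X) (L2 Z)) z = slope X (fst z) *\<^sub>R (L2 (D2 Y Z) z + m z *\<^sub>R L1 grad z)"
    using levi_civitaD(5)[OF D Y' Z' fst_smooth[OF slope_smooth[OF X]]]
    by (simp add: D_L1_L2 X Z L2_fst[OF Y slope_smooth[OF X]] D22)
  moreover have "D (L1 X) (D (L2 Y) (L2 Z)) z = slope X (fst z) *\<^sub>R L2 (D2 Y Z) z +
      (field_apply (L1 X) m z *\<^sub>R L1 grad z + m z *\<^sub>R L1 (D1 X grad) z)"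
    unfolding D22 levi_civitaD(4)[OF D X' L2_field[OF DYZ] mG] levi_civitaD(5)[OF D X' L1_field[OF grad_field] m]
    by (simp add: D_L1_L2 X DYZ D_L1_L1 grad_field)
  moreover have "field_apply (L1 X) m z = slope X (fst z) * m z"
    unfolding m_def field_apply_warping_coeff[OF X' Y Z] L1_g2[OF X Y Z] L1_fst[OF X f_smooth]
    using f_pos[of "fst z"] by (simp add: field_simps)
  moreover have "D (lie_bracket (L1 X) (L2 Y)) (L2 Z) z = 0"
    by (simp add: bracket_L1_L2 X Y D_zero Z')
  ultimately have "curvature D (L1 X) (L2 Y) (L2 Z) z = (- m z) *\<^sub>R L1 (D1 X grad) z"
    by (simp add: curvature_def scaleR_add_right)
  then show ?thesis by (simp add: m_def)
qed

text \<open>The norm of the gradient arises when \<open>L2 U\<close> differentiates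
  \<open>L1 grad\<close>: the slope of \<open>grad f\<close> is its squared norm over
  \<open>f\<close>, and the factor \<open>f\<close> of the coefficient \<open>m\<close> cancels the
  denominator.\<close>

lemma curvature_L2_L2_L2:
  assumes X: "X \<in> vector_fields A2" and Y: "Y \<in> vector_fields A2" and Z: "Z \<in> vector_fields A2"
  shows "curvature D (L2 X) (L2 Y) (L2 Z) z = L2 (curvature D2 X Y Z) z -
    g1 (fst z) (grad (fst z)) (grad (fst z)) *\<^sub>R
      (g2 (snd z) (X (snd z)) (Z (snd z)) *\<^sub>R L2 Y z - g2 (snd z) (Y (snd z)) (Z (snd z)) *\<^sub>R L2 X z)"
proof -
  define N where "N = g1 (fst z) (grad (fst z)) (grad (fst z))"
  have grad_grad: "field_apply grad f (fst z) = N"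
    by (simp add: N_def g1_grad[OF grad_field])
  have double: "D (L2 U) (D (L2 V) (L2 Z)) z = L2 (D2 U (D2 V Z)) z
      + (- (f (fst z) * (g2 (snd z) (U (snd z)) (D2 V Z (snd z))
            + field_apply U (\<lambda>y. g2 y (V y) (Z y)) (snd z)))) *\<^sub>R L1 grad z
      - (N * g2 (snd z) (V (snd z)) (Z (snd z))) *\<^sub>R L2 U z"
    if U: "U \<in> vector_fields A2" and V: "V \<in> vector_fields A2" for U V
  proof -
    note U' = L2_field[OF U]
    have DVZ: "D2 V Z \<in> vector_fields A2" by (rule levi_civitaD(1)[OF D2 V Z])
    define m where "m z = - (f (fst z) * g2 (snd z) (V (snd z)) (Z (snd z)))" for z
    have m: "smooth_fun A m" unfolding m_def by (rule warping_coeff_smooth[OF V Z])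
    have mG: "(\<lambda>z. m z *\<^sub>R L1 grad z) \<in> vector_fields A"
      by (rule vector_fields_scale[OF A L1_field[OF grad_field] m])
    have D22: "D (L2 V) (L2 Z) = (\<lambda>z. L2 (D2 V Z) z + m z *\<^sub>R L1 grad z)"
      by (simp add: D_L2_L2 V Z m_def)
    have "D (L2 U) (D (L2 V) (L2 Z)) z = D (L2 U) (L2 (D2 V Z)) z +
      (field_apply (L2 U) m z *\<^sub>R L1 grad z + m z *\<^sub>R slope grad (fst z) *\<^sub>R L2 U z)"
      unfolding D22 levi_civitaD(4)[OF D U' L2_field[OF DVZ] mG] levi_civitaD(5)[OF D U' L1_field[OF grad_field] m]
      by (simp add: D_L1_L2 U grad_field)
    moreover have "field_apply (L2 U) m z = - (f (fst z) * field_apply U (\<lambda>y. g2 y (V y) (Z y)) (snd z))"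
      unfolding m_def field_apply_warping_coeff[OF U' V Z] L2_g2[OF U V Z] L2_fst[OF U f_smooth]
      by simp
    moreover have "m z *\<^sub>R slope grad (fst z) *\<^sub>R L2 U z = - ((N * g2 (snd z) (V (snd z)) (Z (snd z))) *\<^sub>R L2 U z)"
      using f_pos[of "fst z"] by (simp add: grad_grad m_def field_simps)
    ultimately show ?thesis
      by (simp add: D_L2_L2[OF U DVZ] scaleR_diff_left scaleR_add_left algebra_simps)
  qed
  have B: "lie_bracket X Y \<in> vector_fields A2" by (rule lie_bracket_vector_field[OF A2 D2 X Y])
  note t = vector_field_tangent
  note d = levi_civitaD(1)[OF D2]
  have "g2 (snd z) (Y (snd z)) (D2 X Z (snd z)) + field_apply Y (\<lambda>y. g2 y (X y) (Z y)) (snd z)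
    - (g2 (snd z) (X (snd z)) (D2 Y Z (snd z)) + field_apply X (\<lambda>y. g2 y (Y y) (Z y)) (snd z))
    + g2 (snd z) (lie_bracket X Y (snd z)) (Z (snd z)) = 0"
    unfolding levi_civitaD(3)[OF D2 Y X Z] levi_civitaD(3)[OF D2 X Y Z] levi_civitaD(2)[OF D2 X Y]
      bilinear_metric_diff[OF b2 t[OF d[OF X Y]] t[OF d[OF Y X]] t[OF Z]]
    by simp
  \<comment> \<open>Metric compatibility and vanishing torsion on the second factor; with this the
    coefficients of \<open>L1 grad\<close> in the three curvature terms add up to 0.\<close>
  then have e: "g2 (snd z) (lie_bracket X Y (snd z)) (Z (snd z)) =
      (g2 (snd z) (X (snd z)) (D2 Y Z (snd z)) + field_apply X (\<lambda>y. g2 y (Y y) (Z y)) (snd z))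
      - (g2 (snd z) (Y (snd z)) (D2 X Z (snd z)) + field_apply Y (\<lambda>y. g2 y (X y) (Z y)) (snd z))"
    by linarith
  show ?thesis
    unfolding curvature_def double[OF Y X] double[OF X Y] bracket_L2_L2[OF X Y] D_L2_L2[OF B Z] e
      lift2_linear N_def[symmetric]
    by (simp add: algebra_simps)
qed

end

section \<open>The concircular tensor on lifted fields\<close>

theorem proposition6:
  fixes A1 :: "('a::{t2_space, second_countable_topology}, 'e::euclidean_space) atlas"
    and A2 :: "('b::{t2_space, second_countable_topology}, 'f::euclidean_space) atlas"
    and A :: "('a \<times> 'b, 'e \<times> 'f) atlas"
    and g1 :: "'a metric" and g2 :: "'b metric" and g :: "('a \<times> 'b) metric"
    and D1 :: "'a connection" and D2 :: "'b connection" and D :: "('a \<times> 'b) connection"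
    and f :: "'a \<Rightarrow> real" and \<tau> :: "'a \<times> 'b \<Rightarrow> real" and n :: real
    and X1 Y1 Z1 :: "'a vfield" and X2 Y2 Z2 :: "'b vfield"
    and L1 :: "'a vfield \<Rightarrow> ('a \<times> 'b) vfield" and L2 :: "'b vfield \<Rightarrow> ('a \<times> 'b) vfield"
    and C :: "('a \<times> 'b) vfield \<Rightarrow> ('a \<times> 'b) vfield \<Rightarrow> ('a \<times> 'b) vfield \<Rightarrow> ('a \<times> 'b) vfield"
  assumes "pseudo_riemannian A1 g1" and "pseudo_riemannian A2 g2"
    and "DIM('e) \<ge> 2" and "DIM('f) \<ge> 2"
    and "smooth_fun A1 f" and "\<forall>x. f x > 0"
    and "A = prod_atlas A1 A2" and "g = warped_metric A1 g1 f A2 g2"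
    and "n = real (DIM('e) + DIM('f))"
    and "levi_civita A1 g1 D1" and "levi_civita A2 g2 D2" and "levi_civita A g D"
    and "\<tau> = scalar_curvature A g D" and "C = concircular A g D"
    and "L1 = lift1 A1 A2" and "L2 = lift2 A1 A2"
    and "X1 \<in> vector_fields A1" and "Y1 \<in> vector_fields A1" and "Z1 \<in> vector_fields A1"
    and "X2 \<in> vector_fields A2" and "Y2 \<in> vector_fields A2" and "Z2 \<in> vector_fields A2"
  shows "\<forall>p q.
     C (L1 X1) (L1 Y1) (L1 Z1) (p, q) =
       L1 (curvature D1 X1 Y1 Z1) (p, q) -
       (\<tau> (p, q) / (n * (n - 1))) *\<^sub>R
         (g1 p (X1 p) (Z1 p) *\<^sub>R L1 Y1 (p, q) - g1 p (Y1 p) (Z1 p) *\<^sub>R L1 X1 (p, q)) \<and>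
     C (L2 X2) (L1 Y1) (L1 Z1) (p, q) =
       (1 / f p * hessian A1 g1 D1 f Y1 Z1 p +
         \<tau> (p, q) / (n * (n - 1)) * g1 p (Y1 p) (Z1 p)) *\<^sub>R L2 X2 (p, q) \<and>
     C (L1 X1) (L2 Y2) (L2 Z2) (p, q) =
       (f p * g2 q (Y2 q) (Z2 q)) *\<^sub>R
         (L1 (D1 X1 (gradient A1 g1 f)) (p, q) +
          (\<tau> (p, q) * f p / (n * (n - 1))) *\<^sub>R L1 X1 (p, q)) \<and>
     C (L2 X2) (L2 Y2) (L2 Z2) (p, q) =
       L2 (curvature D2 X2 Y2 Z2) (p, q) -
       (g1 p (gradient A1 g1 f p) (gradient A1 g1 f p) +
         \<tau> (p, q) * (f p)\<^sup>2 / (n * (n - 1))) *\<^sub>R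
         (g2 q (X2 q) (Z2 q) *\<^sub>R L2 Y2 (p, q) - g2 q (Y2 q) (Z2 q) *\<^sub>R L2 X2 (p, q))"
proof (intro allI)
  fix p q
  interpret W: warped_product A1 A2 g1 g2 D1 D2 D f
    by unfold_locales (use assms in auto)
  note [simp] = \<open>A = prod_atlas A1 A2\<close> \<open>g = warped_metric A1 g1 f A2 g2\<close> \<open>L1 = lift1 A1 A2\<close> \<open>L2 = lift2 A1 A2\<close>
  note V = assms(17-22)
  have C: "C X Y Z (p, q) = curvature D X Y Z (p, q) - (\<tau> (p, q) / (n * (n - 1))) *\<^sub>R
      (g (p, q) (X (p, q)) (Z (p, q)) *\<^sub>R Y (p, q) - g (p, q) (Y (p, q)) (Z (p, q)) *\<^sub>R X (p, q))" for X Y Z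
    using assms(9,13,14) by (simp add: concircular_def Let_def)
  show "C (L1 X1) (L1 Y1) (L1 Z1) (p, q) =
       L1 (curvature D1 X1 Y1 Z1) (p, q) -
       (\<tau> (p, q) / (n * (n - 1))) *\<^sub>R
         (g1 p (X1 p) (Z1 p) *\<^sub>R L1 Y1 (p, q) - g1 p (Y1 p) (Z1 p) *\<^sub>R L1 X1 (p, q)) \<and>
     C (L2 X2) (L1 Y1) (L1 Z1) (p, q) =
       (1 / f p * hessian A1 g1 D1 f Y1 Z1 p +
         \<tau> (p, q) / (n * (n - 1)) * g1 p (Y1 p) (Z1 p)) *\<^sub>R L2 X2 (p, q) \<and>
     C (L1 X1) (L2 Y2) (L2 Z2) (p, q) =
       (f p * g2 q (Y2 q) (Z2 q)) *\<^sub>R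
         (L1 (D1 X1 (gradient A1 g1 f)) (p, q) +
          (\<tau> (p, q) * f p / (n * (n - 1))) *\<^sub>R L1 X1 (p, q)) \<and>
     C (L2 X2) (L2 Y2) (L2 Z2) (p, q) =
       L2 (curvature D2 X2 Y2 Z2) (p, q) -
       (g1 p (gradient A1 g1 f p) (gradient A1 g1 f p) +
         \<tau> (p, q) * (f p)\<^sup>2 / (n * (n - 1))) *\<^sub>R
         (g2 q (X2 q) (Z2 q) *\<^sub>R L2 Y2 (p, q) - g2 q (Y2 q) (Z2 q) *\<^sub>R L2 X2 (p, q))"
    \<comment> \<open>Mixed products of lifts are 0, so in the second and third formula only one of
      the two metric terms is left, with the sign reversed by the subtraction. Products of lifts
      from the second factor carry \<open>f^2\<close>, of which one \<open>f\<close> is factored out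
      in the third formula.\<close>
    unfolding C
    by (simp add: V W.curvature_L1_L1_L1 W.curvature_L2_L1_L1 W.curvature_L1_L2_L2 W.curvature_L2_L2_L2
        W.g_L1_L1 W.g_L2_L2 W.g_L1_L2 algebra_simps power2_eq_square)
qed

end
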